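(* Let $2\le M\le N$ and let $\mathbf A\in\mathbb C^{M\times N}$ with $\operatorname{rank}(\mathbf A)\ge1$ and with a simple largest singular value. Let $(\sigma_j)_{j\ge0}$ and $(\mathbf u_j\mathbf v_j^* )_{j\ge0}$ be the sequences generated from $\mathbf A$ by the Cadzow algorithm for rank-1 Hankel approximation. Then the sequence $(\sigma_j)_{j=0}^\infty$ converges. Let $\sigma:=\lim_{j\to\infty}\sigma_j$. If $\sigma=0$, then $\lim_{j\to\infty}\sigma_j\mathbf u_j\mathbf v_j^*=\mathbf 0$. If $\sigma>0$, then the sequence $(\mathbf u_j\mathbf v_j^* )_{j=0}^\infty$ converges, and there exists $z\in\mathbb C$ such that $$\mathbf u\mathbf v^*:=\lim_{j\to\infty}\mathbf u_j\mathbf v_j^*=\mathbf z_M(z)\,\mathbf z_N(z)^T,$$ or $\mathbf u\mathbf v^*=\mathbf e_M\mathbf e_N^T$; i.e., the Cadzow algorithm provides the rank-1 Hankel approximation $\sigma\mathbf u\mathbf v^*$.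
   Context: For $z\in\mathbb C$ and $n\in\mathbb N$, $\mathbf z_n(z):=\bigl(\sum_{k=0}^{n-1}|z|^{2k}\bigr)^{-1/2}(1,z,\dots,z^{n-1})^T\in\mathbb C^n$; $\mathbf e_n:=(0,\dots,0,1)^T\in\mathbb C^n$; $\mathbf v^*=\overline{\mathbf v}^T$. A matrix is Hankel if its $(k,\ell)$ entry depends only on $k+\ell$. $P$ denotes the orthogonal (Frobenius) projection of $\mathbb C^{M\times N}$ onto the subspace of Hankel matrices: every entry of $P(\mathbf B)$ on the antidiagonal $\{(k,\ell):k+\ell=m\}$ equals the average of the entries of $\mathbf B$ on that antidiagonal. Cadzow algorithm (rank-1 case), input $\mathbf A$ with simple largest singular value: let $\sigma_0$ be the largest singular value of $\mathbf A$ with corresponding normalized left and right singular vectors $\mathbf u_0,\mathbf v_0$, and $\mathbf A_0:=\sigma_0\mathbf u_0\mathbf v_0^*$. For $j=1,2,\dots$: set $\tilde{\mathbf A}_j:=P(\mathbf A_{j-1})$, let $\sigma_j$ be the largest singular value of $\tilde{\mathbf A}_j$ with corresponding normalized left and right singular vectors $\mathbf u_j,\mathbf v_j$ (if the best rank-1 approximation is not unique, the first singular vectors given by the SVD algorithm used are taken), and $\mathbf A_j:=\sigma_j\mathbf u_j\mathbf v_j^*$.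
   Formalization: The limit uv* equals z_M(z) z_N(z)^T or e_M e_N^T only up to a complex factor c with |c| = 1; without c the claim fails, e.g. for A = diag(-1,0), where u_j v_j* = A for all j. *)

theory Defs
  imports
    "HOL-Analysis.Analysis"
    "Jordan_Normal_Form.Schur_Decomposition"
    "Jordan_Normal_Form.DL_Rank"
begin

text \<open>The matrix $u v^T$; the rank-one matrix $u v^*$ is \<^term>\<open>outer_prod u (conjugate v)\<close>.\<close>

definition outer_prod :: "complex vec \<Rightarrow> complex vec \<Rightarrow> complex mat" where
  "outer_prod u v = mat (dim_vec u) (dim_vec v) (\<lambda>(i, j). u $ i * v $ j)"

definition unitary_mat :: "nat \<Rightarrow> complex mat \<Rightarrow> bool" where
  "unitary_mat n U \<longleftrightarrow> U \<in> carrier_mat n n \<and> mat_adjoint U * U = 1\<^sub>m n"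

text \<open>Full singular value decomposition $A = U \Sigma V^*$, with the singular values
  $s_0 \ge s_1 \ge \dots \ge 0$ listed with multiplicity; only \<^term>\<open>s i\<close> for
  \<^term>\<open>i < min (dim_row A) (dim_col A)\<close> is meaningful.\<close>

definition is_svd :: "complex mat \<Rightarrow> complex mat \<Rightarrow> (nat \<Rightarrow> real) \<Rightarrow> complex mat \<Rightarrow> bool" where
  "is_svd A U s V \<longleftrightarrow>
     unitary_mat (dim_row A) U \<and> unitary_mat (dim_col A) V \<and>
     (\<forall>i < min (dim_row A) (dim_col A). 0 \<le> s i) \<and>
     (\<forall>j < min (dim_row A) (dim_col A). \<forall>i \<le> j. s j \<le> s i) \<and>
     A = U * mat (dim_row A) (dim_col A) (\<lambda>(i, j). if i = j then complex_of_real (s i) else 0)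
           * mat_adjoint V"

definition simple_largest_singular_value :: "complex mat \<Rightarrow> bool" where
  "simple_largest_singular_value A \<longleftrightarrow>
     (\<exists>U s V. is_svd A U s V \<and> (\<forall>i < min (dim_row A) (dim_col A). 0 < i \<longrightarrow> s i < s 0))"

text \<open>The largest singular value with the first left and right singular vectors of some singular
  value decomposition. If the largest singular value is multiple, the vectors are not determined
  by the matrix, and every choice is admitted.\<close>

definition leading_singular_triple ::
    "complex mat \<Rightarrow> real \<Rightarrow> complex vec \<Rightarrow> complex vec \<Rightarrow> bool" where
  "leading_singular_triple A \<sigma> u v \<longleftrightarrow>
     (\<exists>U s V. is_svd A U s V \<and> \<sigma> = s 0 \<and> u = col U 0 \<and> v = col V 0)"

definition hankel_mat :: "complex mat \<Rightarrow> bool" where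
  "hankel_mat B \<longleftrightarrow>
     (\<forall>i < dim_row B. \<forall>j < dim_col B. \<forall>k < dim_row B. \<forall>l < dim_col B.
        i + j = k + l \<longrightarrow> B $$ (i, j) = B $$ (k, l))"

definition antidiagonal :: "nat \<Rightarrow> nat \<Rightarrow> nat \<Rightarrow> (nat \<times> nat) set" where
  "antidiagonal M N m = {(k, l). k < M \<and> l < N \<and> k + l = m}"

text \<open>Averaging along antidiagonals is the Frobenius-orthogonal projection onto the subspace of
  Hankel matrices.\<close>

definition hankel_proj :: "complex mat \<Rightarrow> complex mat" where
  "hankel_proj B = mat (dim_row B) (dim_col B) (\<lambda>(i, j).
     (\<Sum>kl \<in> antidiagonal (dim_row B) (dim_col B) (i + j). B $$ kl)
       / of_nat (card (antidiagonal (dim_row B) (dim_col B) (i + j))))"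

definition rank1_term :: "real \<Rightarrow> complex vec \<Rightarrow> complex vec \<Rightarrow> complex mat" where
  "rank1_term \<sigma> u v = complex_of_real \<sigma> \<cdot>\<^sub>m outer_prod u (conjugate v)"

text \<open>The sequences \<^term>\<open>\<sigma>\<close>, \<^term>\<open>u\<close>, \<^term>\<open>v\<close> are generated by Cadzow's algorithm with
  input \<^term>\<open>A\<close>. This is a relation rather than a function because of the choice of singular
  vectors; the runs of any particular SVD algorithm are among the sequences it allows.\<close>

definition cadzow_run ::
    "complex mat \<Rightarrow> (nat \<Rightarrow> real) \<Rightarrow> (nat \<Rightarrow> complex vec) \<Rightarrow> (nat \<Rightarrow> complex vec) \<Rightarrow> bool" where
  "cadzow_run A \<sigma> u v \<longleftrightarrow>
     leading_singular_triple A (\<sigma> 0) (u 0) (v 0) \<and>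
     (\<forall>j. leading_singular_triple (hankel_proj (rank1_term (\<sigma> j) (u j) (v j)))
            (\<sigma> (Suc j)) (u (Suc j)) (v (Suc j)))"

definition frobenius_norm :: "complex mat \<Rightarrow> real" where
  "frobenius_norm B = sqrt (\<Sum>i<dim_row B. \<Sum>j<dim_col B. (cmod (B $$ (i, j)))\<^sup>2)"

text \<open>The type of matrices of arbitrary dimensions carries no topology, so convergence is stated
  in the Frobenius norm.\<close>

definition mat_LIMSEQ :: "(nat \<Rightarrow> complex mat) \<Rightarrow> complex mat \<Rightarrow> bool" where
  "mat_LIMSEQ X L \<longleftrightarrow>
     (\<forall>n. X n \<in> carrier_mat (dim_row L) (dim_col L)) \<and>
     (\<lambda>n. frobenius_norm (X n - L)) \<longlonglongrightarrow> 0"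

definition z_vec :: "nat \<Rightarrow> complex \<Rightarrow> complex vec" where
  "z_vec n z = vec n (\<lambda>k. complex_of_real (1 / sqrt (\<Sum>i<n. cmod z ^ (2 * i))) * z ^ k)"

definition e_vec :: "nat \<Rightarrow> complex vec" where
  "e_vec n = unit_vec n (n - 1)"

text \<open>The Hankel matrices of rank one and Frobenius norm one are the matrices
  $c\, z_M(z)\, z_N(z)^T$ and $c\, e_M e_N^T$ with $|c| = 1$. The factor $c$ cannot be
  dropped from a description of the limits of Cadzow's algorithm: for $A = \mathrm{diag}(-1, 0)$,
  a Hankel matrix of rank one, $\sigma_j = 1$ and $u_j v_j^* = A$ for all $j$, whereas the
  $(0,0)$ entry of $z_2(z)\, z_2(z)^T$ is positive and that of $e_2 e_2^T$ is zero.\<close>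

end

theory Submission
  imports Defs
begin

text \<open>
  Let \<open>x\<^sub>j = u\<^sub>j v\<^sub>j\<^sup>*\<close> and let \<open>P\<close> be the projection onto the Hankel matrices. Both steps of the
  algorithm decrease the norm, so \<open>\<sigma>\<^sub>j\<close> decreases to a limit \<open>s\<close>. If \<open>s > 0\<close>, then
  \<open>\<sigma>\<^sub>j\<^sub>+\<^sub>1 / \<sigma>\<^sub>j \<longlonglongrightarrow> 1\<close>, which forces \<open>\<delta>\<^sub>j = \<parallel>x\<^sub>j - P x\<^sub>j\<parallel>\<^sup>2 \<longlonglongrightarrow> 0\<close>. The full sequence \<open>x\<^sub>j\<close>
  converges because \<open>\<delta>\<^sub>j\<close> is eventually contracted by a fixed factor while
  \<open>\<parallel>x\<^sub>j\<^sub>+\<^sub>1 - x\<^sub>j\<parallel>\<close> is of order \<open>sqrt \<delta>\<^sub>j\<close>.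

  The contraction rests on a linear error bound: a unit rank-one matrix within \<open>\<epsilon>\<close> of a Hankel
  matrix is within \<open>C \<epsilon>\<close> of a Hankel matrix \<open>y\<close> of rank one, since
  \<open>u\<^sub>k\<^sub>+\<^sub>1 w\<^sub>l \<approx> u\<^sub>k w\<^sub>l\<^sub>+\<^sub>1\<close> makes both factors nearly geometric with a common ratio. The residual
  \<open>r\<close> of the best rank-one approximation of \<open>P x\<^sub>j\<close> is orthogonal to the tangent space at
  \<open>x\<^sub>j\<^sub>+\<^sub>1\<close>, hence to \<open>y\<close> up to third order in \<open>r\<close>, so that the Hankel direction \<open>P x\<^sub>j - y\<close>
  (up to scaling) carries a fixed proportion of \<open>r\<close>.
\<close>

section \<open>Finite-dimensional norms and tensors\<close>

definition l2_norm :: "'i set \<Rightarrow> ('i \<Rightarrow> complex) \<Rightarrow> real" where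
  "l2_norm A f = L2_set (\<lambda>i. cmod (f i)) A"

text \<open>\<open>inner\<close> on the complex numbers is Re (x * cnj y), so this is the real part
  of the Hermitian inner product. Conditions over all complex vectors, as in
  \<open>leading_pair\<close>, still express complex orthogonality, since the vector may be
  multiplied by the imaginary unit.\<close>

definition l2_inner :: "'i set \<Rightarrow> ('i \<Rightarrow> complex) \<Rightarrow> ('i \<Rightarrow> complex) \<Rightarrow> real" where
  "l2_inner A f g = (\<Sum>i\<in>A. inner (f i) (g i))"

lemma l2_norm_nonneg [simp]: "0 \<le> l2_norm A f"
  by (simp add: l2_norm_def)

lemma l2_norm_sq: "(l2_norm A f)\<^sup>2 = (\<Sum>i\<in>A. (cmod (f i))\<^sup>2)"
  by (simp add: l2_norm_def L2_set_def sum_nonneg)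

lemma l2_inner_self: "l2_inner A f f = (l2_norm A f)\<^sup>2"
  by (simp add: l2_inner_def l2_norm_sq power2_norm_eq_inner)

lemma l2_norm_cong: "(\<And>i. i \<in> A \<Longrightarrow> f i = g i) \<Longrightarrow> l2_norm A f = l2_norm A g"
  by (simp add: l2_norm_def cong: L2_set_cong)

lemma l2_norm_triangle: "l2_norm A (\<lambda>i. f i + g i) \<le> l2_norm A f + l2_norm A g"
proof -
  have "l2_norm A (\<lambda>i. f i + g i) \<le> L2_set (\<lambda>i. cmod (f i) + cmod (g i)) A"
    unfolding l2_norm_def by (rule L2_set_mono) (auto intro: norm_triangle_ineq)
  also have "\<dots> \<le> l2_norm A f + l2_norm A g"
    unfolding l2_norm_def by (rule L2_set_triangle_ineq)
  finally show ?thesis .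
qed

lemma l2_norm_scale: "l2_norm A (\<lambda>i. c * f i) = cmod c * l2_norm A f"
  by (simp add: l2_norm_def norm_mult L2_set_right_distrib)

lemma l2_norm_le_sum: "l2_norm A f \<le> (\<Sum>i\<in>A. cmod (f i))"
  unfolding l2_norm_def by (rule L2_set_le_sum) simp

lemma norm_le_l2_norm: "finite A \<Longrightarrow> i \<in> A \<Longrightarrow> cmod (f i) \<le> l2_norm A f"
  unfolding l2_norm_def by (rule member_le_L2_set)

lemma l2_inner_le: "\<bar>l2_inner A f g\<bar> \<le> l2_norm A f * l2_norm A g"
proof -
  have "\<bar>l2_inner A f g\<bar> \<le> (\<Sum>i\<in>A. \<bar>cmod (f i)\<bar> * \<bar>cmod (g i)\<bar>)"
    unfolding l2_inner_def
    by (rule order_trans[OF sum_abs sum_mono]) (simp add: Cauchy_Schwarz_ineq2)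
  also have "\<dots> \<le> l2_norm A f * l2_norm A g"
    unfolding l2_norm_def by (rule L2_set_mult_ineq)
  finally show ?thesis .
qed

lemma l2_inner_commute: "l2_inner A f g = l2_inner A g f"
  by (simp add: l2_inner_def inner_commute)

lemma l2_inner_add_right: "l2_inner A h (\<lambda>i. f i + g i) = l2_inner A h f + l2_inner A h g"
  by (simp add: l2_inner_def inner_add_right sum.distrib)

lemma l2_inner_diff_left: "l2_inner A (\<lambda>i. f i - g i) h = l2_inner A f h - l2_inner A g h"
  by (simp add: l2_inner_def inner_diff_left sum_subtractf)

lemma l2_inner_diff_right: "l2_inner A h (\<lambda>i. f i - g i) = l2_inner A h f - l2_inner A h g"
  by (simp add: l2_inner_def inner_diff_right sum_subtractf)

lemma inner_of_real_mult_left: "inner (complex_of_real t * x) y = t * inner x y"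
  by (simp add: inner_complex_def algebra_simps)

lemma l2_inner_scale_left: "l2_inner A (\<lambda>i. complex_of_real t * f i) h = t * l2_inner A f h"
  by (simp add: l2_inner_def inner_of_real_mult_left sum_distrib_left)

lemma l2_inner_scale_right: "l2_inner A h (\<lambda>i. complex_of_real t * f i) = t * l2_inner A h f"
  by (metis l2_inner_scale_left l2_inner_commute)

lemma l2_norm_diff_sq:
  "(l2_norm A (\<lambda>i. f i - g i))\<^sup>2 = (l2_norm A f)\<^sup>2 - 2 * l2_inner A f g + (l2_norm A g)\<^sup>2"
  using l2_inner_commute[of A f g]
  by (simp add: l2_inner_self[symmetric] l2_inner_diff_left l2_inner_diff_right)

section \<open>Elementary tensors and their inner products\<close>

definition tensor :: "(nat \<Rightarrow> complex) \<Rightarrow> (nat \<Rightarrow> complex) \<Rightarrow> nat \<times> nat \<Rightarrow> complex" where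
  "tensor a b = (\<lambda>(k, l). a k * b l)"

lemma tensor_apply [simp]: "tensor a b (k, l) = a k * b l"
  by (simp add: tensor_def)

lemma l2_norm_tensor: "l2_norm (A \<times> B) (tensor a b) = l2_norm A a * l2_norm B b"
proof -
  have "(l2_norm (A \<times> B) (tensor a b))\<^sup>2 = (l2_norm A a * l2_norm B b)\<^sup>2"
    by (simp add: power_mult_distrib l2_norm_sq sum_product sum.cartesian_product norm_mult
        tensor_def case_prod_beta)
  then show ?thesis
    by (simp add: power2_eq_iff_nonneg)
qed

text \<open>Summing over the first index first shows that \<open>r\<close> is orthogonal to
  \<open>tensor a b\<close> for every \<open>b\<close> as soon as its contraction with
  \<open>a\<close> vanishes in each column. The singular vector equations enter in this form, and in
  the mirrored form of the next lemma.\<close>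

lemma l2_inner_tensor_right:
  "l2_inner (A \<times> B) r (tensor a b) = (\<Sum>l\<in>B. Re (cnj (b l) * (\<Sum>k\<in>A. r (k, l) * cnj (a k))))"
proof -
  have "l2_inner (A \<times> B) r (tensor a b) = (\<Sum>k\<in>A. \<Sum>l\<in>B. inner (r (k, l)) (a k * b l))"
    by (simp add: l2_inner_def sum.cartesian_product tensor_def case_prod_beta)
  also have "\<dots> = (\<Sum>l\<in>B. \<Sum>k\<in>A. Re (cnj (b l) * (r (k, l) * cnj (a k))))"
    by (subst sum.swap) (simp add: inner_complex_def algebra_simps)
  finally show ?thesis by (simp add: sum_distrib_left)
qed

lemma l2_inner_tensor_right':
  "l2_inner (A \<times> B) r (tensor a b) = (\<Sum>k\<in>A. Re (cnj (a k) * (\<Sum>l\<in>B. r (k, l) * cnj (b l))))"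
proof -
  have "l2_inner (A \<times> B) r (tensor a b) = (\<Sum>k\<in>A. \<Sum>l\<in>B. inner (r (k, l)) (a k * b l))"
    by (simp add: l2_inner_def sum.cartesian_product tensor_def case_prod_beta)
  also have "\<dots> = (\<Sum>k\<in>A. \<Sum>l\<in>B. Re (cnj (a k) * (r (k, l) * cnj (b l))))"
    by (simp add: inner_complex_def algebra_simps)
  finally show ?thesis by (simp add: sum_distrib_left)
qed

section \<open>The error bound for nearly Hankel tensors\<close>

text \<open>Because \<open>cmod z\<close> is at most 1, a step never amplifies the error inherited
  from earlier steps, so the errors merely add up.\<close>

lemma perturbed_geometric:
  fixes f :: "nat \<Rightarrow> complex"
  assumes "cmod z \<le> 1" and "\<And>l. l < n \<Longrightarrow> cmod (f (Suc l) - z * f l) \<le> e" and "l \<le> n"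
  shows "cmod (f l - f 0 * z ^ l) \<le> real l * e"
  using \<open>l \<le> n\<close>
proof (induction l)
  case 0
  then show ?case by simp
next
  case (Suc l)
  have "f (Suc l) - f 0 * z ^ Suc l = (f (Suc l) - z * f l) + z * (f l - f 0 * z ^ l)"
    by (simp add: algebra_simps)
  also have "cmod \<dots> \<le> e + cmod z * cmod (f l - f 0 * z ^ l)"
    using assms(2)[of l] Suc.prems by (intro norm_triangle_le add_mono) (auto simp: norm_mult)
  also have "\<dots> \<le> e + 1 * (real l * e)"
    using assms(1) Suc by (intro add_left_mono mult_mono) auto
  finally show ?case by (simp add: algebra_simps)
qed

lemma perturbed_geometric_l2:
  fixes f :: "nat \<Rightarrow> complex"
  assumes "cmod z \<le> 1" and "\<And>l. l < n \<Longrightarrow> cmod (f (Suc l) - z * f l) \<le> e" and "0 \<le> e"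
  shows "l2_norm {..<Suc n} (\<lambda>l. f l - f 0 * z ^ l) \<le> real (Suc n) * real n * e"
proof -
  have "l2_norm {..<Suc n} (\<lambda>l. f l - f 0 * z ^ l) \<le> (\<Sum>l<Suc n. cmod (f l - f 0 * z ^ l))"
    by (rule l2_norm_le_sum)
  also have "\<dots> \<le> (\<Sum>l<Suc n. real n * e)"
  proof (rule sum_mono)
    fix l assume l: "l \<in> {..<Suc n}"
    have "cmod (f l - f 0 * z ^ l) \<le> real l * e"
      using perturbed_geometric[where f = f and n = n, OF assms(1,2)] l by auto
    also have "\<dots> \<le> real n * e"
      using l assms(3) by (intro mult_right_mono) auto
    finally show "cmod (f l - f 0 * z ^ l) \<le> real n * e" .
  qed
  finally show ?thesis by simp
qed

text \<open>The ratio \<open>z\<close> is the least-squares solution of \<open>U (k + 1) = z * U k\<close>; the first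
  assumption keeps it in the unit disc.\<close>

lemma forward_error_bound:
  fixes U W H :: "nat \<Rightarrow> complex"
  assumes "0 < m" "0 < n"
    and U1: "l2_norm {..<Suc m} U = 1" and W1: "l2_norm {..<Suc n} W = 1"
    and le: "(\<Sum>k<m. (cmod (U (Suc k)))\<^sup>2) \<le> (\<Sum>k<m. (cmod (U k))\<^sup>2)"
    and H: "\<And>k l. k \<le> m \<Longrightarrow> l \<le> n \<Longrightarrow> cmod (U k * W l - H (k + l)) \<le> \<epsilon>"
    and small: "real (Suc n) * real n * (4 * real m) * \<epsilon> \<le> 1/2"
  shows "\<exists>z. l2_norm {..<Suc m} (\<lambda>k. U k - U 0 * z ^ k)
               \<le> real (Suc m) * real m * ((2 + 4 * real m) * (2 * real (Suc n))) * \<epsilon> \<and>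
             l2_norm {..<Suc n} (\<lambda>l. W l - W 0 * z ^ l)
               \<le> real (Suc n) * real n * (4 * real m) * \<epsilon>"
proof -
  define S where "S = (\<Sum>k<m. (cmod (U k))\<^sup>2)"
  define z where "z = (\<Sum>k<m. cnj (U k) * U (Suc k)) / complex_of_real S"
  have eps: "0 \<le> \<epsilon>"
    using H[of 0 0] by (meson norm_ge_zero order_trans zero_le)
  \<comment> \<open>The last entry of \<open>U\<close> is among the shifted entries, so
    \<open>le\<close> bounds its square by \<open>S\<close>; hence 1 is at most
    \<open>2 * S\<close>.\<close>
  have "1 = (\<Sum>k<Suc m. (cmod (U k))\<^sup>2)"
    using U1 by (simp add: l2_norm_sq[symmetric])
  also have "\<dots> = S + (cmod (U m))\<^sup>2"
    by (simp add: S_def)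
  also have "(cmod (U m))\<^sup>2 \<le> (\<Sum>k<m. (cmod (U (Suc k)))\<^sup>2)"
    using member_le_sum[of "m - 1" "{..<m}" "\<lambda>k. (cmod (U (Suc k)))\<^sup>2"] \<open>0 < m\<close> by simp
  finally have S: "S \<ge> 1/2"
    using le by (simp add: S_def)
  then have "S > 0" by simp
  have Uk: "cmod (U k) \<le> 1" if "k \<le> m" for k
    using norm_le_l2_norm[of "{..<Suc m}" k U] U1 that by simp
  \<comment> \<open>Cauchy-Schwarz bounds the numerator of \<open>z\<close> by the geometric mean of
    \<open>S\<close> and the shifted sum, and \<open>le\<close> bounds the latter by
    \<open>S\<close>.\<close>
  have z1: "cmod z \<le> 1"
  proof -
    have "cmod (\<Sum>k<m. cnj (U k) * U (Suc k)) \<le> (\<Sum>k<m. \<bar>cmod (U k)\<bar> * \<bar>cmod (U (Suc k))\<bar>)"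
      by (rule order_trans[OF norm_sum]) (simp add: norm_mult)
    also have "\<dots> \<le> L2_set (\<lambda>k. cmod (U k)) {..<m} * L2_set (\<lambda>k. cmod (U (Suc k))) {..<m}"
      by (rule L2_set_mult_ineq)
    also have "\<dots> \<le> sqrt S * sqrt S"
      using le by (intro mult_mono) (auto simp: L2_set_def S_def sum_nonneg)
    finally show ?thesis
      using \<open>S > 0\<close> by (simp add: z_def norm_divide)
  qed
  \<comment> \<open>Both products are \<open>\<epsilon>\<close>-close to the same value
    \<open>H (k + l + 1)\<close>.\<close>
  have swap: "cmod (U (Suc k) * W l - U k * W (Suc l)) \<le> 2 * \<epsilon>" if "k < m" "l < n" for k l
  proof -
    have "U (Suc k) * W l - U k * W (Suc l)
        = (U (Suc k) * W l - H (Suc k + l)) - (U k * W (Suc l) - H (k + Suc l))" by simp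
    also have "cmod \<dots> \<le> \<epsilon> + \<epsilon>"
      using that by (intro norm_triangle_le_diff add_mono H) auto
    finally show ?thesis by simp
  qed
  \<comment> \<open>Weighting \<open>swap\<close> by \<open>cnj (U k)\<close> and summing over
    \<open>k\<close> produces exactly \<open>S * (W (Suc l) - z * W l)\<close>, up to sign. The
    \<open>m\<close> terms contribute \<open>2 * \<epsilon>\<close> each, and dividing by
    \<open>S\<close>, which is at least 1/2, doubles the sum.\<close>
  have Wstep: "cmod (W (Suc l) - z * W l) \<le> 4 * real m * \<epsilon>" if l: "l < n" for l
  proof -
    have "complex_of_real S * W (Suc l) = (\<Sum>k<m. cnj (U k) * U k * W (Suc l))"
      by (simp only: S_def of_real_sum sum_distrib_right complex_norm_square mult.commute[of "cnj _"])
    moreover have "complex_of_real S * (z * W l) = (\<Sum>k<m. cnj (U k) * U (Suc k) * W l)"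
      using \<open>S > 0\<close> by (simp add: z_def sum_distrib_right)
    ultimately have "complex_of_real S * (W (Suc l) - z * W l)
        = - (\<Sum>k<m. cnj (U k) * (U (Suc k) * W l - U k * W (Suc l)))"
      by (simp add: algebra_simps sum_subtractf)
    then have "S * cmod (W (Suc l) - z * W l)
        = cmod (\<Sum>k<m. cnj (U k) * (U (Suc k) * W l - U k * W (Suc l)))"
      using \<open>S > 0\<close> by (metis abs_of_pos norm_minus_cancel norm_mult norm_of_real)
    also have "\<dots> \<le> (\<Sum>k<m. 1 * (2 * \<epsilon>))"
      unfolding norm_mult complex_mod_cnj
      by (rule order_trans[OF norm_sum sum_mono], unfold norm_mult complex_mod_cnj)
        (intro mult_mono, use Uk swap l in auto)
    finally have "S * cmod (W (Suc l) - z * W l) \<le> 2 * real m * \<epsilon>" by simp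
    moreover have "1/2 * cmod (W (Suc l) - z * W l) \<le> S * cmod (W (Suc l) - z * W l)"
      using S by (intro mult_right_mono) auto
    ultimately show ?thesis by simp
  qed
  have Wb: "l2_norm {..<Suc n} (\<lambda>l. W l - W 0 * z ^ l) \<le> real (Suc n) * real n * (4 * real m) * \<epsilon>"
    using perturbed_geometric_l2[where f = W and n = n, OF z1 Wstep] eps by (simp add: mult.assoc)
  \<comment> \<open>By \<open>small\<close>, \<open>W\<close> is within 1/2 of its geometric model,
    whose norm is at most \<open>(n + 1) * cmod (W 0)\<close>. Since \<open>W\<close> has norm one,
    \<open>W 0\<close> cannot be small.\<close>
  have W0: "1 \<le> 2 * real (Suc n) * cmod (W 0)"
  proof -
    have "1 = l2_norm {..<Suc n} (\<lambda>l. W 0 * z ^ l + (W l - W 0 * z ^ l))"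
      using W1 by simp
    also have "\<dots> \<le> l2_norm {..<Suc n} (\<lambda>l. W 0 * z ^ l) + l2_norm {..<Suc n} (\<lambda>l. W l - W 0 * z ^ l)"
      by (rule l2_norm_triangle)
    also have "l2_norm {..<Suc n} (\<lambda>l. W 0 * z ^ l) \<le> (\<Sum>l<Suc n. cmod (W 0) * 1)"
    proof (rule order_trans[OF l2_norm_le_sum sum_mono])
      fix l
      show "cmod (W 0 * z ^ l) \<le> cmod (W 0) * 1"
        unfolding norm_mult norm_power using z1
        by (intro mult_left_mono power_le_one) auto
    qed
    finally have "1 \<le> real (Suc n) * cmod (W 0) + l2_norm {..<Suc n} (\<lambda>l. W l - W 0 * z ^ l)"
      by simp
    moreover have "l2_norm {..<Suc n} (\<lambda>l. W l - W 0 * z ^ l) \<le> 1/2"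
      using Wb small by (rule order_trans)
    ultimately show ?thesis by linarith
  qed
  \<comment> \<open>The ratio is now carried from \<open>W\<close> back to \<open>U\<close>. The
    numerator adds the bounds of \<open>swap\<close> and \<open>Wstep\<close> at
    \<open>l = 0\<close>; dividing by \<open>W 0\<close> costs
    \<open>2 * real (Suc n)\<close>.\<close>
  define e2 where "e2 = (2 + 4 * real m) * (2 * real (Suc n)) * \<epsilon>"
  have Ustep: "cmod (U (Suc k) - z * U k) \<le> e2" if k: "k < m" for k
  proof -
    have "(U (Suc k) - z * U k) * W 0
        = (U (Suc k) * W 0 - U k * W (Suc 0)) + U k * (W (Suc 0) - z * W 0)"
      by (simp add: algebra_simps)
    also have "cmod \<dots> \<le> 2 * \<epsilon> + 1 * (4 * real m * \<epsilon>)"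
    proof (intro norm_triangle_le add_mono)
      show "cmod (U (Suc k) * W 0 - U k * W (Suc 0)) \<le> 2 * \<epsilon>"
        using swap k \<open>0 < n\<close> by blast
      show "cmod (U k * (W (Suc 0) - z * W 0)) \<le> 1 * (4 * real m * \<epsilon>)"
        unfolding norm_mult using Uk[of k] Wstep[of 0] k \<open>0 < n\<close>
        by (intro mult_mono) auto
    qed
    finally have *: "cmod (U (Suc k) - z * U k) * cmod (W 0) \<le> (2 + 4 * real m) * \<epsilon>"
      unfolding norm_mult by (simp add: distrib_right)
    have "cmod (U (Suc k) - z * U k) * 1 \<le> cmod (U (Suc k) - z * U k) * (2 * real (Suc n) * cmod (W 0))"
      by (rule mult_left_mono[OF W0]) simp
    also have "\<dots> = 2 * real (Suc n) * (cmod (U (Suc k) - z * U k) * cmod (W 0))"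
      by (simp only: mult_ac)
    also have "\<dots> \<le> 2 * real (Suc n) * ((2 + 4 * real m) * \<epsilon>)"
      by (rule mult_left_mono[OF *]) simp
    finally show ?thesis by (simp add: e2_def mult_ac)
  qed
  have "l2_norm {..<Suc m} (\<lambda>k. U k - U 0 * z ^ k) \<le> real (Suc m) * real m * e2"
    by (rule perturbed_geometric_l2[where f = U and n = m, OF z1 Ustep]) (use eps in \<open>simp_all add: e2_def\<close>)
  then show ?thesis
    using Wb unfolding e2_def mult.assoc by blast
qed

text \<open>Counting exponents from the far end replaces a ratio outside the unit disc by its
  inverse. With \<open>z = 0\<close> this alternative gives the multiples of \<open>e_vec\<close>,
  the limit of infinite ratio.\<close>

definition geometric_pair :: "nat \<Rightarrow> nat \<Rightarrow> (nat \<Rightarrow> complex) \<Rightarrow> (nat \<Rightarrow> complex) \<Rightarrow> bool" where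
  "geometric_pair M N a b \<longleftrightarrow> (\<exists>z \<alpha> \<beta>.
     a = (\<lambda>k. \<alpha> * z ^ k) \<and> b = (\<lambda>l. \<beta> * z ^ l) \<or>
     a = (\<lambda>k. \<alpha> * z ^ (M - 1 - k)) \<and> b = (\<lambda>l. \<beta> * z ^ (N - 1 - l)))"

lemma l2_norm_reverse: "l2_norm {..<Suc m} (\<lambda>k. f (m - k)) = l2_norm {..<Suc m} f"
proof -
  have "(l2_norm {..<Suc m} (\<lambda>k. f (m - k)))\<^sup>2 = (l2_norm {..<Suc m} f)\<^sup>2"
    unfolding l2_norm_sq by (rule sum.reindex_bij_witness[where i = "\<lambda>k. m - k" and j = "\<lambda>k. m - k"]) auto
  then show ?thesis by (simp add: power2_eq_iff_nonneg)
qed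

text \<open>One \<open>C\<close> serves both as error factor and as size restriction on
  \<open>\<epsilon>\<close>. It does not depend on \<open>U\<close>, \<open>W\<close> or
  \<open>H\<close>, so a single choice works along the whole iteration.\<close>

definition geometric_error_constant :: "nat \<Rightarrow> nat \<Rightarrow> real \<Rightarrow> bool" where
  "geometric_error_constant M N C \<longleftrightarrow> 1 \<le> C \<and>
     (\<forall>U W H \<epsilon>. l2_norm {..<M} U = 1 \<longrightarrow> l2_norm {..<N} W = 1 \<longrightarrow> C * \<epsilon> \<le> 1 \<longrightarrow>
        (\<forall>k<M. \<forall>l<N. cmod (U k * W l - H (k + l)) \<le> \<epsilon>) \<longrightarrow>
        (\<exists>a b. geometric_pair M N a b \<and> l2_norm {..<M} (\<lambda>k. U k - a k) \<le> C * \<epsilon> \<and>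
           l2_norm {..<N} (\<lambda>l. W l - b l) \<le> C * \<epsilon>))"

lemma geometric_error_constantE:
  assumes "geometric_error_constant M N C" "l2_norm {..<M} U = 1" "l2_norm {..<N} W = 1" "C * \<epsilon> \<le> 1"
    and "\<And>k l. k < M \<Longrightarrow> l < N \<Longrightarrow> cmod (U k * W l - H (k + l)) \<le> \<epsilon>"
  obtains a b where "geometric_pair M N a b" "l2_norm {..<M} (\<lambda>k. U k - a k) \<le> C * \<epsilon>"
    "l2_norm {..<N} (\<lambda>l. W l - b l) \<le> C * \<epsilon>"
proof -
  have "\<forall>k<M. \<forall>l<N. cmod (U k * W l - H (k + l)) \<le> \<epsilon>"
    using assms(5) by blast
  with assms(1-4) show thesis
    unfolding geometric_error_constant_def using that by blast
qed

text \<open>Either \<open>U\<close> or its reversal meets the inequality that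
  \<open>forward_error_bound\<close> needs.\<close>

lemma geometric_error_bound:
  fixes M N :: nat
  assumes "2 \<le> M" "2 \<le> N"
  shows "\<exists>C. geometric_error_constant M N C"
proof -
  obtain m n where mn: "M = Suc m" "N = Suc n" "0 < m" "0 < n"
    using assms by (cases M; cases N) auto
  define C1 where "C1 = real (Suc n) * real n * (4 * real m)"
  define C2 where "C2 = real (Suc m) * real m * ((2 + 4 * real m) * (2 * real (Suc n)))"
  have C1: "C1 \<ge> 1"
  proof -
    have "C1 = real (Suc n * n * (4 * m))" unfolding C1_def by (simp only: of_nat_mult of_nat_numeral)
    also have "\<dots> \<ge> real 1" using mn by (subst of_nat_le_iff) simp
    finally show ?thesis by simp
  qed
  have C2: "C2 \<ge> 0" by (simp add: C2_def)
  show ?thesis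
    unfolding geometric_error_constant_def
  proof (intro exI[of _ "2 * C1 + C2"] conjI allI impI)
    show "1 \<le> 2 * C1 + C2" using C1 C2 by simp
    fix U W H :: "nat \<Rightarrow> complex" and \<epsilon> :: real
    assume U: "l2_norm {..<M} U = 1" and W: "l2_norm {..<N} W = 1"
      and small: "(2 * C1 + C2) * \<epsilon> \<le> 1"
      and "\<forall>k<M. \<forall>l<N. cmod (U k * W l - H (k + l)) \<le> \<epsilon>"
    then have H: "\<And>k l. k < M \<Longrightarrow> l < N \<Longrightarrow> cmod (U k * W l - H (k + l)) \<le> \<epsilon>"
      by blast
    have eps: "0 \<le> \<epsilon>"
      using H[of 0 0] mn by (meson norm_ge_zero order_trans zero_less_Suc)
    have le1: "C1 * \<epsilon> \<le> (2 * C1 + C2) * \<epsilon>" and le2: "C2 * \<epsilon> \<le> (2 * C1 + C2) * \<epsilon>"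
      using C1 C2 eps by (auto intro!: mult_right_mono)
    \<comment> \<open>The summand \<open>2 * C1\<close> of the constant is there for this: it yields
      the smallness required by \<open>forward_error_bound\<close>.\<close>
    have sm: "C1 * \<epsilon> \<le> 1/2"
      using small mult_nonneg_nonneg[OF C2 eps] by (simp add: distrib_right)
    show "\<exists>a b. geometric_pair M N a b \<and>
       l2_norm {..<M} (\<lambda>k. U k - a k) \<le> (2 * C1 + C2) * \<epsilon> \<and>
       l2_norm {..<N} (\<lambda>l. W l - b l) \<le> (2 * C1 + C2) * \<epsilon>"
    proof (cases "(\<Sum>k<m. (cmod (U (Suc k)))\<^sup>2) \<le> (\<Sum>k<m. (cmod (U k))\<^sup>2)")
      case True
      obtain z where "l2_norm {..<Suc m} (\<lambda>k. U k - U 0 * z ^ k) \<le> C2 * \<epsilon>"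
        "l2_norm {..<Suc n} (\<lambda>l. W l - W 0 * z ^ l) \<le> C1 * \<epsilon>"
        using forward_error_bound[of m n U W H \<epsilon>] mn U W True H sm unfolding C1_def C2_def
        by (auto simp: less_Suc_eq_le)
      then show ?thesis
        using le1 le2 mn
        by (intro exI[of _ "\<lambda>k. U 0 * z ^ k"] exI[of _ "\<lambda>l. W 0 * z ^ l"])
          (auto simp: geometric_pair_def)
    next
      \<comment> \<open>Both index ranges are reversed. This turns the inequality between the two
        sums around, and reflecting the index of \<open>H\<close> about \<open>m + n\<close>
        preserves the Hankel structure.\<close>
      case False
      have r1: "(\<Sum>k<m. (cmod (U (m - k)))\<^sup>2) = (\<Sum>k<m. (cmod (U (Suc k)))\<^sup>2)"
        by (rule sum.reindex_bij_witness[where i = "\<lambda>k. m - 1 - k" and j = "\<lambda>k. m - 1 - k"])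
          (auto simp: Suc_diff_Suc)
      have r2: "(\<Sum>k<m. (cmod (U (m - Suc k)))\<^sup>2) = (\<Sum>k<m. (cmod (U k))\<^sup>2)"
        by (rule sum.reindex_bij_witness[where i = "\<lambda>k. m - Suc k" and j = "\<lambda>k. m - Suc k"]) auto
      have H': "cmod (U (m - k) * W (n - l) - H (m + n - (k + l))) \<le> \<epsilon>" if "k \<le> m" "l \<le> n" for k l
        using H[of "m - k" "n - l"] that mn by (simp add: add_ac)
      obtain z where z: "l2_norm {..<Suc m} (\<lambda>k. U (m - k) - U m * z ^ k) \<le> C2 * \<epsilon>"
        "l2_norm {..<Suc n} (\<lambda>l. W (n - l) - W n * z ^ l) \<le> C1 * \<epsilon>"
        using forward_error_bound[of m n "\<lambda>k. U (m - k)" "\<lambda>l. W (n - l)" "\<lambda>j. H (m + n - j)" \<epsilon>]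
          mn U W False H' sm unfolding C1_def C2_def
        by (auto simp: l2_norm_reverse r1 r2)
      have "l2_norm {..<Suc m} (\<lambda>k. U k - U m * z ^ (m - k)) = l2_norm {..<Suc m} (\<lambda>k. U (m - k) - U m * z ^ k)"
        "l2_norm {..<Suc n} (\<lambda>k. W k - W n * z ^ (n - k)) = l2_norm {..<Suc n} (\<lambda>k. W (n - k) - W n * z ^ k)"
        by (subst l2_norm_reverse[symmetric], rule l2_norm_cong, simp)+
      then show ?thesis
        using z le1 le2 mn
        by (intro exI[of _ "\<lambda>k. U m * z ^ (m - k)"] exI[of _ "\<lambda>l. W n * z ^ (n - l)"])
          (auto simp: geometric_pair_def)
    qed
  qed
qed

section \<open>One step of the algorithm\<close>

text \<open>The condition is imposed on all index pairs, not only on the grid, so that linear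
  combinations need no range conditions.\<close>

definition hankel_fun :: "(nat \<times> nat \<Rightarrow> complex) \<Rightarrow> bool" where
  "hankel_fun f \<longleftrightarrow> (\<exists>h. f = (\<lambda>(k, l). h (k + l)))"

lemma hankel_fun_combine:
  "hankel_fun f \<Longrightarrow> hankel_fun g \<Longrightarrow> hankel_fun (\<lambda>p. f p + c * g p)"
  unfolding hankel_fun_def
proof (elim exE)
  fix h h' assume "f = (\<lambda>(k, l). h (k + l))" "g = (\<lambda>(k, l). h' (k + l))"
  then show "\<exists>h. (\<lambda>p. f p + c * g p) = (\<lambda>(k, l). h (k + l))"
    by (intro exI[of _ "\<lambda>i. h i + c * h' i"]) auto
qed

lemma hankel_fun_scale: "hankel_fun f \<Longrightarrow> hankel_fun (\<lambda>p. c * f p)"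
  using hankel_fun_combine[of "\<lambda>_. 0" f c] by (auto simp: hankel_fun_def)

text \<open>A reversed pair adds its exponents correctly only on the grid, since subtraction on
  \<open>nat\<close> is truncated outside it; hence a Hankel function that agrees with the tensor
  there.\<close>

lemma geometric_pair_hankel:
  assumes "geometric_pair M N a b"
  shows "\<exists>f. hankel_fun f \<and> (\<forall>p\<in>{..<M} \<times> {..<N}. f p = tensor a b p)"
proof -
  obtain z \<alpha> \<beta> where
    "a = (\<lambda>k. \<alpha> * z ^ k) \<and> b = (\<lambda>l. \<beta> * z ^ l) \<or>
     a = (\<lambda>k. \<alpha> * z ^ (M - 1 - k)) \<and> b = (\<lambda>l. \<beta> * z ^ (N - 1 - l))"
    using assms unfolding geometric_pair_def by blast
  then show ?thesis
  proof
    assume "a = (\<lambda>k. \<alpha> * z ^ k) \<and> b = (\<lambda>l. \<beta> * z ^ l)"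
    then show ?thesis
      by (intro exI[of _ "\<lambda>(k, l). \<alpha> * \<beta> * z ^ (k + l)"])
        (auto simp: hankel_fun_def power_add intro!: exI[of _ "\<lambda>i. \<alpha> * \<beta> * z ^ i"])
  next
    assume ab: "a = (\<lambda>k. \<alpha> * z ^ (M - 1 - k)) \<and> b = (\<lambda>l. \<beta> * z ^ (N - 1 - l))"
    have e: "z ^ (M - 1 + (N - 1) - (k + l)) = z ^ (M - 1 - k) * z ^ (N - 1 - l)" if "k < M" "l < N" for k l
    proof -
      have "M - 1 + (N - 1) - (k + l) = (M - 1 - k) + (N - 1 - l)"
        using that by simp
      then show ?thesis by (simp only: power_add)
    qed
    let ?h = "\<lambda>i. \<alpha> * \<beta> * z ^ (M - 1 + (N - 1) - i)"
    have "hankel_fun (\<lambda>(k, l). ?h (k + l))"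
      unfolding hankel_fun_def by (rule exI) (rule refl)
    moreover have "(\<lambda>(k, l). ?h (k + l)) p = tensor a b p" if "p \<in> {..<M} \<times> {..<N}" for p
      using that e[of "fst p" "snd p"] ab by (simp only: case_prod_beta tensor_def mem_Times_iff lessThan_iff mult_ac)
    ultimately show ?thesis by blast
  qed
qed

text \<open>\<open>\<rho> * tensor U W\<close> is a best rank-one approximation of \<open>g\<close>: the residual is orthogonal to the
  tangent space of the rank-one matrices at \<open>tensor U W\<close>, and \<open>\<rho>\<close> is the spectral norm of \<open>g\<close>.\<close>

definition leading_pair ::
    "nat \<Rightarrow> nat \<Rightarrow> (nat \<times> nat \<Rightarrow> complex) \<Rightarrow> real \<Rightarrow> (nat \<Rightarrow> complex) \<Rightarrow> (nat \<Rightarrow> complex) \<Rightarrow> bool" where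
  "leading_pair M N g \<rho> U W \<longleftrightarrow>
     l2_norm {..<M} U = 1 \<and> l2_norm {..<N} W = 1 \<and>
     (\<forall>c. l2_inner ({..<M} \<times> {..<N}) (\<lambda>p. g p - \<rho> * tensor U W p) (tensor U c) = 0) \<and>
     (\<forall>c. l2_inner ({..<M} \<times> {..<N}) (\<lambda>p. g p - \<rho> * tensor U W p) (tensor c W) = 0) \<and>
     (\<forall>a b. l2_norm {..<M} a = 1 \<longrightarrow> l2_norm {..<N} b = 1 \<longrightarrow>
        l2_inner ({..<M} \<times> {..<N}) (tensor a b) g \<le> \<rho>)"

text \<open>Orthogonality characterises the projection and is all that the estimates use; the
  averages along antidiagonals appear only in \<open>is_hankel_proj_average\<close>. The values of
  \<open>g\<close> are determined on the grid only.\<close>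

definition is_hankel_proj ::
    "nat \<Rightarrow> nat \<Rightarrow> (nat \<times> nat \<Rightarrow> complex) \<Rightarrow> (nat \<times> nat \<Rightarrow> complex) \<Rightarrow> bool" where
  "is_hankel_proj M N x g \<longleftrightarrow> hankel_fun g \<and>
     (\<forall>h. hankel_fun h \<longrightarrow> l2_inner ({..<M} \<times> {..<N}) (\<lambda>p. x p - g p) h = 0)"

lemma is_hankel_proj_scale:
  assumes "is_hankel_proj M N x g"
  shows "is_hankel_proj M N (\<lambda>p. complex_of_real t * x p) (\<lambda>p. complex_of_real t * g p)"
  unfolding is_hankel_proj_def
proof (intro conjI allI impI)
  show "hankel_fun (\<lambda>p. complex_of_real t * g p)"
    using assms by (auto simp: is_hankel_proj_def intro: hankel_fun_scale)
  fix h assume "hankel_fun h"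
  then have "l2_inner ({..<M} \<times> {..<N}) (\<lambda>p. x p - g p) h = 0"
    using assms by (simp add: is_hankel_proj_def)
  then show "l2_inner ({..<M} \<times> {..<N}) (\<lambda>p. complex_of_real t * x p - complex_of_real t * g p) h = 0"
    unfolding right_diff_distrib[symmetric] l2_inner_scale_left by simp
qed

text \<open>Pythagoras: \<open>h - g\<close> is a Hankel function and therefore orthogonal to
  \<open>x - g\<close>.\<close>

lemma is_hankel_proj_minimal:
  assumes "is_hankel_proj M N x g" "hankel_fun h"
  shows "l2_norm ({..<M} \<times> {..<N}) (\<lambda>p. x p - g p) \<le> l2_norm ({..<M} \<times> {..<N}) (\<lambda>p. x p - h p)"
proof -
  let ?A = "{..<M} \<times> {..<N}"
  have "hankel_fun (\<lambda>p. h p + (-1) * g p)"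
    using assms by (intro hankel_fun_combine) (auto simp: is_hankel_proj_def)
  then have 0: "l2_inner ?A (\<lambda>p. x p - g p) (\<lambda>p. h p - g p) = 0"
    using assms(1) by (simp add: is_hankel_proj_def)
  have "(l2_norm ?A (\<lambda>p. x p - h p))\<^sup>2 = (l2_norm ?A (\<lambda>p. (x p - g p) - (h p - g p)))\<^sup>2"
    by simp
  also have "\<dots> = (l2_norm ?A (\<lambda>p. x p - g p))\<^sup>2 + (l2_norm ?A (\<lambda>p. h p - g p))\<^sup>2"
    using 0 by (simp only: l2_norm_diff_sq[of ?A "\<lambda>p. x p - g p" "\<lambda>p. h p - g p"])
  finally have "(l2_norm ?A (\<lambda>p. x p - g p))\<^sup>2 \<le> (l2_norm ?A (\<lambda>p. x p - h p))\<^sup>2"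
    using zero_le_power2[of "l2_norm ?A (\<lambda>p. h p - g p)"] by linarith
  then show ?thesis
    by (rule power2_le_imp_le) simp
qed

lemma is_hankel_proj_inner_self:
  assumes "is_hankel_proj M N x g"
  shows "l2_inner ({..<M} \<times> {..<N}) x g = (l2_norm ({..<M} \<times> {..<N}) g)\<^sup>2"
proof -
  have "l2_inner ({..<M} \<times> {..<N}) (\<lambda>p. x p - g p) g = 0"
    using assms by (simp add: is_hankel_proj_def)
  then show ?thesis by (simp add: l2_inner_diff_left l2_inner_self)
qed

lemma is_hankel_proj_defect:
  assumes "is_hankel_proj M N x g"
  shows "(l2_norm ({..<M} \<times> {..<N}) (\<lambda>p. x p - g p))\<^sup>2
    = (l2_norm ({..<M} \<times> {..<N}) x)\<^sup>2 - (l2_norm ({..<M} \<times> {..<N}) g)\<^sup>2"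
  using is_hankel_proj_inner_self[OF assms] by (simp add: l2_norm_diff_sq)

lemma is_hankel_proj_norm_le:
  assumes "is_hankel_proj M N x g"
  shows "l2_norm ({..<M} \<times> {..<N}) g \<le> l2_norm ({..<M} \<times> {..<N}) x"
proof (rule power2_le_imp_le)
  show "(l2_norm ({..<M} \<times> {..<N}) g)\<^sup>2 \<le> (l2_norm ({..<M} \<times> {..<N}) x)\<^sup>2"
    using is_hankel_proj_defect[OF assms]
      zero_le_power2[of "l2_norm ({..<M} \<times> {..<N}) (\<lambda>p. x p - g p)"] by linarith
qed simp

section \<open>Estimates for best rank-one approximations\<close>

lemma leading_pair_inner:
  assumes "leading_pair M N g \<rho> U W"
  shows "l2_inner ({..<M} \<times> {..<N}) (tensor U W) g = \<rho>"
proof -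
  let ?A = "{..<M} \<times> {..<N}"
  have "l2_inner ?A (\<lambda>p. g p - \<rho> * tensor U W p) (tensor U W) = 0"
    using assms by (auto simp: leading_pair_def)
  moreover have "(l2_norm ?A (tensor U W))\<^sup>2 = 1"
    using assms by (simp add: leading_pair_def l2_norm_tensor)
  ultimately show ?thesis
    by (simp add: l2_inner_diff_left l2_inner_scale_left l2_inner_self l2_inner_commute)
qed

lemma leading_pair_cong:
  assumes "\<And>p. p \<in> {..<M} \<times> {..<N} \<Longrightarrow> g p = g' p" "leading_pair M N g \<rho> U W"
  shows "leading_pair M N g' \<rho> U W"
proof -
  have "l2_inner ({..<M} \<times> {..<N}) (\<lambda>p. g' p - \<rho> * tensor U W p) f
      = l2_inner ({..<M} \<times> {..<N}) (\<lambda>p. g p - \<rho> * tensor U W p) f"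
    "l2_inner ({..<M} \<times> {..<N}) f g' = l2_inner ({..<M} \<times> {..<N}) f g" for f
    unfolding l2_inner_def by (auto intro!: sum.cong simp: assms(1))
  with assms(2) show ?thesis by (simp add: leading_pair_def)
qed

lemma leading_pair_scale:
  assumes "leading_pair M N g \<rho> U W" "0 \<le> t"
  shows "leading_pair M N (\<lambda>p. complex_of_real t * g p) (t * \<rho>) U W"
proof -
  have "(\<lambda>p. complex_of_real t * g p - complex_of_real (t * \<rho>) * tensor U W p)
      = (\<lambda>p. complex_of_real t * (g p - \<rho> * tensor U W p))"
    by (simp add: algebra_simps)
  with assms show ?thesis
    by (simp add: leading_pair_def l2_inner_scale_left l2_inner_scale_right mult_left_mono)
qed

lemma leading_pair_le_norm:
  assumes "leading_pair M N g \<rho> U W"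
  shows "\<rho> \<le> l2_norm ({..<M} \<times> {..<N}) g"
  using l2_inner_le[of "{..<M} \<times> {..<N}" "tensor U W" g] leading_pair_inner[OF assms] assms
  by (simp add: leading_pair_def l2_norm_tensor)

text \<open>The old factors \<open>a\<close>, \<open>b\<close> compete in the maximality of
  \<open>\<rho>\<close>, and their inner product with \<open>g\<close> is the squared norm
  \<open>1 - \<delta>\<close> of \<open>g\<close>; this is the lower bound. By Pythagoras the
  squared residual is \<open>1 - \<delta> - \<rho>^2\<close>, hence at most
  \<open>\<delta> - \<delta>^2\<close>.\<close>

lemma leading_pair_bounds:
  assumes x: "l2_norm {..<M} a = 1" "l2_norm {..<N} b = 1"
    and P: "is_hankel_proj M N (tensor a b) g"
    and L: "leading_pair M N g \<rho> U W"
    and \<delta>: "\<delta> = (l2_norm ({..<M} \<times> {..<N}) (\<lambda>p. tensor a b p - g p))\<^sup>2"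
  shows "1 - \<delta> \<le> \<rho>" "\<rho>\<^sup>2 \<le> 1 - \<delta>" "0 \<le> \<rho>"
    "(l2_norm ({..<M} \<times> {..<N}) (\<lambda>p. g p - \<rho> * tensor U W p))\<^sup>2 = 1 - \<delta> - \<rho>\<^sup>2"
    "(l2_norm ({..<M} \<times> {..<N}) (\<lambda>p. g p - \<rho> * tensor U W p))\<^sup>2 \<le> \<delta>"
proof -
  let ?A = "{..<M} \<times> {..<N}"
  have g: "(l2_norm ?A g)\<^sup>2 = 1 - \<delta>"
    using is_hankel_proj_defect[OF P] x by (simp add: \<delta> l2_norm_tensor)
  have 0: "0 \<le> \<delta>" by (simp add: \<delta>)
  have 1: "0 \<le> 1 - \<delta>" unfolding g[symmetric] by simp
  show r: "1 - \<delta> \<le> \<rho>"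
    using L x unfolding leading_pair_def g[symmetric] is_hankel_proj_inner_self[OF P, symmetric] by blast
  with 1 show r0: "0 \<le> \<rho>" by simp
  have U: "l2_norm ?A (tensor U W) = 1"
    using L by (simp add: leading_pair_def l2_norm_tensor)
  show n: "(l2_norm ?A (\<lambda>p. g p - \<rho> * tensor U W p))\<^sup>2 = 1 - \<delta> - \<rho>\<^sup>2"
    using leading_pair_inner[OF L] l2_inner_commute[of ?A "tensor U W" g] U
    by (simp add: l2_norm_diff_sq l2_inner_scale_right l2_norm_scale power_mult_distrib g)
      (simp add: power2_eq_square)
  then show "\<rho>\<^sup>2 \<le> 1 - \<delta>"
    using zero_le_power2[of "l2_norm ?A (\<lambda>p. g p - \<rho> * tensor U W p)"] by linarith
  have "(1 - \<delta>)\<^sup>2 \<le> \<rho>\<^sup>2"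
    using r 1 by (intro power_mono) auto
  then have "1 - \<delta> - \<rho>\<^sup>2 \<le> \<delta> - \<delta>\<^sup>2"
    by (simp add: power2_eq_square algebra_simps)
  then show "(l2_norm ?A (\<lambda>p. g p - \<rho> * tensor U W p))\<^sup>2 \<le> \<delta>"
    using n zero_le_power2[of \<delta>] by linarith
qed

text \<open>Triangle inequality along \<open>tensor a b\<close>, \<open>g\<close>,
  \<open>\<rho> * tensor U W\<close>, \<open>tensor U W\<close>: the first two distances are at most
  \<open>sqrt \<delta>\<close>, the last is \<open>1 - \<rho>\<close>, at most
  \<open>\<delta>\<close>.\<close>

lemma leading_pair_move:
  assumes x: "l2_norm {..<M} a = 1" "l2_norm {..<N} b = 1"
    and P: "is_hankel_proj M N (tensor a b) g"
    and L: "leading_pair M N g \<rho> U W"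
    and \<delta>: "\<delta> = (l2_norm ({..<M} \<times> {..<N}) (\<lambda>p. tensor a b p - g p))\<^sup>2"
  shows "l2_norm ({..<M} \<times> {..<N}) (\<lambda>p. tensor U W p - tensor a b p) \<le> 2 * sqrt \<delta> + \<delta>"
proof -
  let ?A = "{..<M} \<times> {..<N}"
  note b = leading_pair_bounds[OF assms]
  have d0: "0 \<le> \<delta>" by (simp add: \<delta>)
  have r: "l2_norm ?A (\<lambda>p. (-1) * (g p - \<rho> * tensor U W p)) \<le> sqrt \<delta>"
    unfolding l2_norm_scale using b(5) by (simp add: real_le_rsqrt)
  have e: "l2_norm ?A (\<lambda>p. (-1) * (tensor a b p - g p)) = sqrt \<delta>"
    unfolding l2_norm_scale by (simp add: \<delta>)
  have "\<rho>\<^sup>2 \<le> 1"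
    using b(2) d0 by linarith
  then have "\<rho> \<le> 1"
    using b(3) by (simp add: power_le_one_iff)
  have s: "l2_norm ?A (\<lambda>p. complex_of_real (1 - \<rho>) * tensor U W p) \<le> \<delta>"
    using b(1) \<open>\<rho> \<le> 1\<close> L unfolding l2_norm_scale norm_of_real l2_norm_tensor
    by (simp add: leading_pair_def)
  have "l2_norm ?A (\<lambda>p. tensor U W p - tensor a b p)
    = l2_norm ?A (\<lambda>p. ((-1) * (g p - \<rho> * tensor U W p) + (-1) * (tensor a b p - g p))
        + complex_of_real (1 - \<rho>) * tensor U W p)"
    by (simp add: algebra_simps)
  also have "\<dots> \<le> (sqrt \<delta> + sqrt \<delta>) + \<delta>"
    by (rule order_trans[OF l2_norm_triangle add_mono[OF order_trans[OF l2_norm_triangle add_mono] s]])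
      (use r e in auto)
  finally show ?thesis by simp
qed

text \<open>\<open>tensor a b\<close> differs from the tensor of the differences
  \<open>U - a\<close> and \<open>W - b\<close> only by tangent terms \<open>U b\<close>,
  \<open>a W\<close> and \<open>U W\<close>, to which the residual is orthogonal. What remains is a
  product of two small factors.\<close>

lemma leading_pair_second_order:
  assumes L: "leading_pair M N g \<rho> U W"
  shows "\<bar>l2_inner ({..<M} \<times> {..<N}) (\<lambda>p. g p - \<rho> * tensor U W p) (tensor a b)\<bar>
    \<le> l2_norm ({..<M} \<times> {..<N}) (\<lambda>p. g p - \<rho> * tensor U W p)
       * (l2_norm {..<M} (\<lambda>k. U k - a k) * l2_norm {..<N} (\<lambda>l. W l - b l))"
proof -
  let ?A = "{..<M} \<times> {..<N}"
  let ?r = "\<lambda>p. g p - \<rho> * tensor U W p"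
  have t0: "l2_inner ?A ?r (tensor U c) = 0" "l2_inner ?A ?r (tensor c W) = 0" for c
    using L by (auto simp: leading_pair_def)
  have "tensor a b = (\<lambda>p. ((tensor (\<lambda>k. U k - a k) (\<lambda>l. W l - b l) p + tensor U b p) + tensor a W p) - tensor U W p)"
    by (auto simp: algebra_simps)
  then have "l2_inner ?A ?r (tensor a b)
      = l2_inner ?A ?r (\<lambda>p. ((tensor (\<lambda>k. U k - a k) (\<lambda>l. W l - b l) p + tensor U b p) + tensor a W p) - tensor U W p)"
    by (rule arg_cong)
  also have "\<dots> = l2_inner ?A ?r (tensor (\<lambda>k. U k - a k) (\<lambda>l. W l - b l))"
    unfolding l2_inner_diff_right l2_inner_add_right t0 by simp
  finally show ?thesis
    using l2_inner_le[of ?A ?r "tensor (\<lambda>k. U k - a k) (\<lambda>l. W l - b l)"]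
    by (simp add: l2_norm_tensor)
qed

section \<open>Contraction of the distance to the Hankel matrices\<close>

lemma tensor_near:
  assumes "l2_norm A U = 1" "l2_norm B W = 1" "l2_norm A (\<lambda>k. U k - a k) \<le> t"
    "l2_norm B (\<lambda>l. W l - b l) \<le> t" "t \<le> 1"
  shows "l2_norm (A \<times> B) (\<lambda>p. tensor U W p - tensor a b p) \<le> 3 * t"
proof -
  have t0: "0 \<le> t" using assms(3) l2_norm_nonneg order_trans by blast
  have "(\<lambda>p. tensor U W p - tensor a b p) = (\<lambda>p. (tensor (\<lambda>k. U k - a k) W p + tensor U (\<lambda>l. W l - b l) p)
      + (-1) * tensor (\<lambda>k. U k - a k) (\<lambda>l. W l - b l) p)"
    by (auto simp: algebra_simps)
  then have "l2_norm (A \<times> B) (\<lambda>p. tensor U W p - tensor a b p)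
    = l2_norm (A \<times> B) (\<lambda>p. (tensor (\<lambda>k. U k - a k) W p + tensor U (\<lambda>l. W l - b l) p)
      + (-1) * tensor (\<lambda>k. U k - a k) (\<lambda>l. W l - b l) p)"
    by (rule arg_cong)
  also have "\<dots> \<le> (t * 1 + 1 * t) + 1 * (t * t)"
    by (rule order_trans[OF l2_norm_triangle add_mono[OF order_trans[OF l2_norm_triangle add_mono]]];
        (unfold l2_norm_scale)?; unfold l2_norm_tensor; (intro mult_mono)?) (use assms t0 in auto)
  also have "t * t \<le> t * 1" using assms(5) t0 by (intro mult_left_mono)
  finally show ?thesis by simp
qed

text \<open>One step contracts the squared distance \<open>\<delta>\<close> to the Hankel matrices: moving from \<open>g\<close> towards
  the nearby Hankel matrix \<open>\<rho> * tensor a b\<close> of rank one shortens the residual \<open>r\<close> by a fixed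
  factor, because \<open>r\<close> is nearly orthogonal to \<open>tensor a b\<close>.\<close>

lemma cadzow_contraction:
  assumes C: "geometric_error_constant M N C" and D: "D = (1 + 3 * C)\<^sup>2"
    and x: "l2_norm {..<M} a0 = 1" "l2_norm {..<N} b0 = 1"
    and P: "is_hankel_proj M N (tensor a0 b0) g"
    and L: "leading_pair M N g \<rho> U W"
    and P': "is_hankel_proj M N (tensor U W) g'"
    and \<delta>: "\<delta> = (l2_norm ({..<M} \<times> {..<N}) (\<lambda>p. tensor a0 b0 p - g p))\<^sup>2"
    and dD: "\<delta> \<le> 1 / (16 * D)" and dC: "\<delta> \<le> 1 / (16 * C ^ 4)"
  shows "(l2_norm ({..<M} \<times> {..<N}) (\<lambda>p. tensor U W p - g' p))\<^sup>2 \<le> (1 - 1 / (8 * D)) * \<delta>"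
proof -
  let ?A = "{..<M} \<times> {..<N}"
  have C1: "C \<ge> 1" using C by (simp add: geometric_error_constant_def)
  have D1: "D \<ge> 1" using C1 unfolding D by (intro one_le_power) auto
  define q where "q = 1 - 1 / (8 * D)"
  have "0 \<le> q" "q < 1" using D1 by (auto simp: q_def field_simps)
  note bd = leading_pair_bounds[OF x P L \<delta>]
  define r where "r = (\<lambda>p. g p - \<rho> * tensor U W p)"
  define R where "R = l2_norm ?A r"
  have R0: "0 \<le> R" and R2: "R\<^sup>2 \<le> \<delta>"
    using bd(5) by (auto simp: R_def r_def)
  have d0: "0 \<le> \<delta>" by (simp add: \<delta>)
  have "1 / (16 * D) \<le> 1 / 16" using D1 by (simp add: field_simps)
  with dD have d16: "\<delta> \<le> 1/16" by linarith
  then have rho: "\<rho> \<ge> 15/16" using bd(1) by linarith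
  have U1: "l2_norm {..<M} U = 1" and W1: "l2_norm {..<N} W = 1"
    using L by (auto simp: leading_pair_def)
  \<comment> \<open>Entrywise, the Hankel function \<open>g / \<rho>\<close> lies within
    \<open>\<epsilon>\<close> of \<open>tensor U W\<close>. The bound \<open>dC\<close> is chosen so
    that \<open>2 * C^2 * \<epsilon>\<close> is at most 1, which keeps the third-order term in
    \<open>ry\<close> at most half of \<open>R^2\<close>.\<close>
  define \<epsilon> where "\<epsilon> = R / \<rho>"
  have \<epsilon>0: "0 \<le> \<epsilon>" using R0 rho by (simp add: \<epsilon>_def)
  have "(4 * C\<^sup>2 * R)\<^sup>2 \<le> 16 * C ^ 4 * \<delta>"
    using R2 by (simp add: power_mult_distrib power_mult[symmetric] mult_left_mono)
  also have "\<dots> \<le> 1" using dC C1 by (simp add: field_simps)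
  finally have "4 * C\<^sup>2 * R \<le> 1"
    using R0 by (simp add: power_le_one_iff)
  then have CR: "2 * C\<^sup>2 * \<epsilon> \<le> 1"
    using rho unfolding \<epsilon>_def by (simp add: field_simps)
  have "C * 1 \<le> C * C" using C1 by (intro mult_left_mono) auto
  then have "C * \<epsilon> \<le> C\<^sup>2 * \<epsilon>" using \<epsilon>0 by (intro mult_right_mono) (auto simp: power2_eq_square)
  then have C\<epsilon>: "C * \<epsilon> \<le> 1" using CR by linarith
  have re: "\<rho> * \<epsilon> = R" using rho by (simp add: \<epsilon>_def)
  obtain h where h: "g = (\<lambda>(k, l). h (k + l))"
    using P by (auto simp: is_hankel_proj_def hankel_fun_def)
  obtain a b where gp: "geometric_pair M N a b"
    and Ua: "l2_norm {..<M} (\<lambda>k. U k - a k) \<le> C * \<epsilon>"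
    and Wb: "l2_norm {..<N} (\<lambda>l. W l - b l) \<le> C * \<epsilon>"
  proof (rule geometric_error_constantE[OF C U1 W1 C\<epsilon>, where H = "\<lambda>i. h i / \<rho>"])
    fix k l assume kl: "k < M" "l < N"
    have "U k * W l - h (k + l) / \<rho> = - (r (k, l) / \<rho>)"
      using rho by (simp add: r_def h field_simps)
    then have "cmod (U k * W l - h (k + l) / \<rho>) = cmod (r (k, l)) / \<rho>"
      using rho by (simp add: norm_divide)
    also have "\<dots> \<le> R / \<rho>"
      unfolding R_def using rho kl by (intro divide_right_mono norm_le_l2_norm) auto
    finally show "cmod (U k * W l - h (k + l) / \<rho>) \<le> \<epsilon>" by (simp add: \<epsilon>_def)
  qed
  obtain y where y: "hankel_fun y" "\<And>p. p \<in> ?A \<Longrightarrow> y p = tensor a b p"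
    using geometric_pair_hankel[OF gp] by blast
  \<comment> \<open>The Hankel direction in which \<open>g\<close> is improved. Its length is at
    most \<open>R\<close> for the residual plus \<open>3 * C * R\<close> for replacing
    \<open>tensor U W\<close> by \<open>tensor a b\<close>; this is the origin of
    \<open>D\<close>.\<close>
  define d where "d = (\<lambda>p. g p - \<rho> * y p)"
  have d_norm: "l2_norm ?A d \<le> (1 + 3 * C) * R"
  proof -
    have "l2_norm ?A d = l2_norm ?A (\<lambda>p. r p + \<rho> * (tensor U W p - tensor a b p))"
      by (rule l2_norm_cong) (simp add: d_def r_def y algebra_simps)
    also have "\<dots> \<le> R + \<rho> * (3 * (C * \<epsilon>))"
      unfolding R_def
      by (rule order_trans[OF l2_norm_triangle]; unfold l2_norm_scale; intro add_mono mult_mono)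
        (use rho \<epsilon>0 C1 tensor_near[OF U1 W1 Ua Wb C\<epsilon>] in auto)
    also have "\<dots> = R + 3 * C * (\<rho> * \<epsilon>)" by simp
    finally show ?thesis unfolding re by (simp add: algebra_simps)
  qed
  \<comment> \<open>The residual is orthogonal to \<open>tensor U W\<close>, so only its own part of
    \<open>g\<close> contributes.\<close>
  have rg: "l2_inner ?A r g = R\<^sup>2"
  proof -
    have "g = (\<lambda>p. r p + \<rho> * tensor U W p)" by (simp add: r_def)
    then have "l2_inner ?A r g = l2_inner ?A r (\<lambda>p. r p + \<rho> * tensor U W p)" by (rule arg_cong)
    also have "\<dots> = R\<^sup>2 + \<rho> * l2_inner ?A r (tensor U W)"
      by (simp add: l2_inner_add_right l2_inner_scale_right l2_inner_self R_def)
    also have "l2_inner ?A r (tensor U W) = 0"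
      using L by (auto simp: leading_pair_def r_def)
    finally show ?thesis by simp
  qed
  have ry: "\<rho> * l2_inner ?A r y \<le> R\<^sup>2 / 2"
  proof -
    have "l2_inner ?A r y = l2_inner ?A r (tensor a b)"
      unfolding l2_inner_def by (rule sum.cong) (auto simp: y)
    also have "\<dots> \<le> R * ((C * \<epsilon>) * (C * \<epsilon>))"
      using leading_pair_second_order[OF L, of a b] Ua Wb unfolding R_def r_def
      by (smt (verit, best) l2_norm_nonneg mult_left_mono mult_mono)
    finally have "\<rho> * l2_inner ?A r y \<le> \<rho> * (R * ((C * \<epsilon>) * (C * \<epsilon>)))"
      using rho by (intro mult_left_mono) auto
    also have "\<dots> = R * (\<rho> * \<epsilon>) * (C\<^sup>2 * \<epsilon>)"
      by (simp add: power2_eq_square)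
    also have "\<dots> \<le> R * (\<rho> * \<epsilon>) * (1/2)"
      using CR R0 re by (intro mult_left_mono) auto
    finally show ?thesis by (simp add: re power2_eq_square)
  qed
  have rd: "l2_inner ?A r d \<ge> R\<^sup>2 / 2"
    unfolding d_def l2_inner_diff_right l2_inner_scale_right rg using ry by simp
  have d2: "(l2_norm ?A d)\<^sup>2 \<le> D * R\<^sup>2"
    using power_mono[OF d_norm l2_norm_nonneg, of 2] by (simp add: D power_mult_distrib)
  \<comment> \<open>The minimiser of \<open>- \<tau> * R^2 + \<tau>^2 * D * R^2\<close>; the gain is
    the fraction \<open>1 / (4 * D)\<close> of \<open>R^2\<close>.\<close>
  define \<tau> where "\<tau> = 1 / (2 * D)"
  have \<tau>0: "\<tau> > 0" using D1 by (simp add: \<tau>_def)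
  \<comment> \<open>The projection of \<open>\<rho> * tensor U W\<close> is at least as close to it
    as the Hankel function \<open>g - \<tau> * d\<close>.\<close>
  have "\<rho> * l2_norm ?A (\<lambda>p. tensor U W p - g' p) = l2_norm ?A (\<lambda>p. \<rho> * tensor U W p - \<rho> * g' p)"
    using bd(3) by (simp add: l2_norm_scale right_diff_distrib[symmetric])
  also have "\<dots> \<le> l2_norm ?A (\<lambda>p. \<rho> * tensor U W p - (g p + (- \<tau>) * d p))"
  proof (rule is_hankel_proj_minimal[OF is_hankel_proj_scale[OF P']])
    have "hankel_fun g" using P by (simp add: is_hankel_proj_def)
    moreover have "hankel_fun d"
      using hankel_fun_combine[OF \<open>hankel_fun g\<close> y(1), of "- \<rho>"] by (simp add: d_def)
    ultimately show "hankel_fun (\<lambda>p. g p + (- \<tau>) * d p)" by (rule hankel_fun_combine)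
  qed
  also have "\<dots> = l2_norm ?A (\<lambda>p. (-1) * (r p - \<tau> * d p))"
    by (simp add: r_def algebra_simps)
  also have "\<dots> = l2_norm ?A (\<lambda>p. r p - \<tau> * d p)"
    unfolding l2_norm_scale by simp
  finally have "(\<rho> * l2_norm ?A (\<lambda>p. tensor U W p - g' p))\<^sup>2 \<le> (l2_norm ?A (\<lambda>p. r p - \<tau> * d p))\<^sup>2"
    using bd(3) by (intro power_mono) auto
  also have "\<dots> = R\<^sup>2 - 2 * \<tau> * l2_inner ?A r d + \<tau>\<^sup>2 * (l2_norm ?A d)\<^sup>2"
    by (simp add: l2_norm_diff_sq l2_inner_scale_right l2_norm_scale power_mult_distrib R_def)
  also have "\<dots> \<le> R\<^sup>2 - 2 * \<tau> * (R\<^sup>2 / 2) + \<tau>\<^sup>2 * (D * R\<^sup>2)"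
    using rd d2 \<tau>0 by (intro add_mono diff_mono mult_left_mono) auto
  also have "\<dots> = (1 - 1 / (4 * D)) * R\<^sup>2"
    using D1 by (simp add: \<tau>_def field_simps power2_eq_square)
  also have "\<dots> \<le> (1 - 1 / (4 * D)) * \<delta>"
    using R2 D1 by (intro mult_left_mono) (auto simp: field_simps)
  \<comment> \<open>Half of the gain \<open>1 / (4 * D)\<close> pays for the later division by
    \<open>\<rho>^2\<close>, which is at least \<open>1 - 2 * \<delta>\<close>; \<open>dD\<close>
    makes \<open>2 * \<delta>\<close> at most \<open>1 / (8 * D)\<close>.\<close>
  also have "\<dots> \<le> (q * (1 - 2 * \<delta>)) * \<delta>"
  proof (rule mult_right_mono[OF _ d0])
    define w where "w = 1 / (8 * D)"
    have "0 \<le> \<delta> * w" using d0 D1 by (simp add: w_def)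
    moreover have "2 * \<delta> \<le> w" using dD by (simp add: w_def)
    moreover have "1 / (4 * D) = 2 * w" by (simp add: w_def)
    moreover have "q * (1 - 2 * \<delta>) = 1 - w - 2 * \<delta> + 2 * (\<delta> * w)"
      unfolding q_def w_def[symmetric] by (simp add: algebra_simps)
    ultimately show "1 - 1 / (4 * D) \<le> q * (1 - 2 * \<delta>)" by linarith
  qed
  also have "\<dots> \<le> \<rho>\<^sup>2 * (q * \<delta>)"
  proof -
    have "(1 - \<delta>)\<^sup>2 \<le> \<rho>\<^sup>2" using bd(1) d16 by (intro power_mono) auto
    moreover have "(1 - \<delta>)\<^sup>2 = 1 - 2 * \<delta> + \<delta>\<^sup>2" by (simp add: power2_eq_square algebra_simps)
    ultimately have "1 - 2 * \<delta> \<le> \<rho>\<^sup>2"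
      using zero_le_power2[of \<delta>] by linarith
    from mult_right_mono[OF this, of "q * \<delta>"] show ?thesis
      using \<open>0 \<le> q\<close> d0 by (simp add: mult_ac)
  qed
  finally have "\<rho>\<^sup>2 * (l2_norm ?A (\<lambda>p. tensor U W p - g' p))\<^sup>2 \<le> \<rho>\<^sup>2 * (q * \<delta>)"
    by (simp add: power_mult_distrib)
  moreover have "0 < \<rho>\<^sup>2" using rho by simp
  ultimately show ?thesis unfolding q_def by (rule mult_left_le_imp_le)
qed

section \<open>Convergence of the normalised iteration\<close>

lemma l2_norm_geometric:
  "l2_norm {..<n} (\<lambda>k. \<alpha> * z ^ k) = cmod \<alpha> * sqrt (\<Sum>i<n. cmod z ^ (2 * i))"
  by (simp add: l2_norm_scale) (simp add: l2_norm_def L2_set_def norm_power power_mult[symmetric] mult.commute)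

lemma unit_geometric:
  assumes "l2_norm {..<n} (\<lambda>k. \<alpha> * z ^ k) = 1"
  shows "\<exists>c. cmod c = 1 \<and> (\<forall>k<n. \<alpha> * z ^ k = c * z_vec n z $ k)"
proof -
  define S where "S = sqrt (\<Sum>i<n. cmod z ^ (2 * i))"
  have 1: "cmod \<alpha> * S = 1"
    using assms unfolding l2_norm_geometric S_def .
  have "S \<ge> 0" unfolding S_def by (intro real_sqrt_ge_zero sum_nonneg) simp
  moreover have "S \<noteq> 0" using 1 by auto
  ultimately show ?thesis
    unfolding z_vec_def S_def[symmetric] using 1
    by (intro exI[of _ "\<alpha> * complex_of_real S"]) (simp add: norm_mult)
qed

definition rank1_hankel_form :: "nat \<Rightarrow> nat \<Rightarrow> complex \<Rightarrow> (nat \<times> nat \<Rightarrow> complex) \<Rightarrow> bool" where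
  "rank1_hankel_form M N c T \<longleftrightarrow>
     (\<exists>z. \<forall>k<M. \<forall>l<N. T (k, l) = c * (z_vec M z $ k * z_vec N z $ l)) \<or>
     (\<forall>k<M. \<forall>l<N. T (k, l) = c * (e_vec M $ k * e_vec N $ l))"

lemma geometric_pair_unit:
  assumes "2 \<le> M" "2 \<le> N" and ab: "geometric_pair M N a b"
    and a1: "l2_norm {..<M} a = 1" and b1: "l2_norm {..<N} b = 1"
  shows "\<exists>c. cmod c = 1 \<and> rank1_hankel_form M N c (tensor a b)"
proof -
  have forward: ?thesis
    if ab': "\<And>k. k < M \<Longrightarrow> a k = \<alpha> * z ^ k" "\<And>l. l < N \<Longrightarrow> b l = \<beta> * z ^ l" for z \<alpha> \<beta>
  proof -
    have "l2_norm {..<M} a = l2_norm {..<M} (\<lambda>k. \<alpha> * z ^ k)"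
      "l2_norm {..<N} b = l2_norm {..<N} (\<lambda>l. \<beta> * z ^ l)"
      using ab' by (auto intro!: l2_norm_cong)
    then have n: "l2_norm {..<M} (\<lambda>k. \<alpha> * z ^ k) = 1" "l2_norm {..<N} (\<lambda>l. \<beta> * z ^ l) = 1"
      using a1 b1 by simp_all
    obtain c where c: "cmod c = 1" "\<And>k. k < M \<Longrightarrow> \<alpha> * z ^ k = c * z_vec M z $ k"
      using unit_geometric[OF n(1)] by blast
    obtain d where d: "cmod d = 1" "\<And>l. l < N \<Longrightarrow> \<beta> * z ^ l = d * z_vec N z $ l"
      using unit_geometric[OF n(2)] by blast
    have "tensor a b (k, l) = c * d * (z_vec M z $ k * z_vec N z $ l)" if "k < M" "l < N" for k l
      using ab'(1)[OF that(1)] ab'(2)[OF that(2)] c(2)[OF that(1)] d(2)[OF that(2)]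
      by (simp only: tensor_apply mult_ac)
    then have "rank1_hankel_form M N (c * d) (tensor a b)"
      unfolding rank1_hankel_form_def by blast
    moreover have "cmod (c * d) = 1" using c d by (simp add: norm_mult)
    ultimately show ?thesis by blast
  qed
  obtain z \<alpha> \<beta> where
    "a = (\<lambda>k. \<alpha> * z ^ k) \<and> b = (\<lambda>l. \<beta> * z ^ l) \<or>
     a = (\<lambda>k. \<alpha> * z ^ (M - 1 - k)) \<and> b = (\<lambda>l. \<beta> * z ^ (N - 1 - l))"
    using ab unfolding geometric_pair_def by blast
  then show ?thesis
  proof
    assume "a = (\<lambda>k. \<alpha> * z ^ k) \<and> b = (\<lambda>l. \<beta> * z ^ l)"
    then show ?thesis using forward[of \<alpha> z \<beta>] by blast
  next
    assume ab': "a = (\<lambda>k. \<alpha> * z ^ (M - 1 - k)) \<and> b = (\<lambda>l. \<beta> * z ^ (N - 1 - l))"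
    show ?thesis
    \<comment> \<open>For nonzero \<open>z\<close> the reversed progressions are forward ones with
      ratio \<open>1 / z\<close>. For \<open>z = 0\<close> only the last entries survive, because
      the power with exponent 0 is 1.\<close>
    proof (cases "z = 0")
      case False
      have inv: "z ^ (n - 1 - k) = z ^ (n - 1) * (1 / z) ^ k" if "k < n" for k n :: nat
        using that False by (simp add: power_diff power_one_over)
      have "a k = \<alpha> * z ^ (M - 1) * (1 / z) ^ k" if "k < M" for k
        using ab' inv[OF that] by simp
      moreover have "b l = \<beta> * z ^ (N - 1) * (1 / z) ^ l" if "l < N" for l
        using ab' inv[OF that] by simp
      ultimately show ?thesis
        using forward[of "\<alpha> * z ^ (M - 1)" "1 / z" "\<beta> * z ^ (N - 1)"] by blast
    next
      case True
      have a: "a k = (if k = M - 1 then \<alpha> else 0)" if "k < M" for k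
        using ab' True that by (auto simp: power_0_left)
      have b: "b l = (if l = N - 1 then \<beta> else 0)" if "l < N" for l
        using ab' True that by (auto simp: power_0_left)
      have n: "(l2_norm {..<n} f)\<^sup>2 = (cmod \<gamma>)\<^sup>2"
        if "2 \<le> n" "\<And>k. k < n \<Longrightarrow> f k = (if k = n - 1 then \<gamma> else 0)" for n :: nat and f \<gamma>
      proof -
        have "(l2_norm {..<n} f)\<^sup>2 = (\<Sum>k<n. if k = n - 1 then (cmod \<gamma>)\<^sup>2 else 0)"
          unfolding l2_norm_sq by (rule sum.cong) (auto simp: that(2))
        also have "\<dots> = (cmod \<gamma>)\<^sup>2" using that(1) by (subst sum.delta) auto
        finally show ?thesis .
      qed
      have "cmod \<alpha> = 1"
        using n[OF assms(1) a] a1 by (simp add: power2_eq_1_iff) (smt (verit) norm_ge_zero)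
      moreover have "cmod \<beta> = 1"
        using n[OF assms(2) b] b1 by (simp add: power2_eq_1_iff) (smt (verit) norm_ge_zero)
      ultimately show ?thesis
        by (intro exI[of _ "\<alpha> * \<beta>"] conjI)
          (auto simp: norm_mult a b rank1_hankel_form_def e_vec_def)
    qed
  qed
qed

text \<open>Vanishing minors make \<open>T\<close> a tensor of two unit vectors. The error bound
  with \<open>\<epsilon> = 0\<close> then says that these vectors form a geometric pair
  exactly.\<close>

lemma unit_rank1_hankel:
  fixes T :: "nat \<times> nat \<Rightarrow> complex"
  assumes "2 \<le> M" "2 \<le> N" and T1: "l2_norm ({..<M} \<times> {..<N}) T = 1"
    and minor: "\<And>k k' l l'. k < M \<Longrightarrow> k' < M \<Longrightarrow> l < N \<Longrightarrow> l' < N \<Longrightarrow>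
      T (k, l) * T (k', l') = T (k, l') * T (k', l)"
    and hankel: "\<And>k k' l l'. k < M \<Longrightarrow> k' < M \<Longrightarrow> l < N \<Longrightarrow> l' < N \<Longrightarrow>
      k + l = k' + l' \<Longrightarrow> T (k, l) = T (k', l')"
  shows "\<exists>c. cmod c = 1 \<and> rank1_hankel_form M N c T"
proof -
  let ?A = "{..<M} \<times> {..<N}"
  have "\<exists>p\<in>?A. T p \<noteq> 0"
  proof (rule ccontr)
    assume "\<not> ?thesis"
    then have "l2_norm ?A T = l2_norm ?A (\<lambda>_. 0)" by (intro l2_norm_cong) auto
    then show False using T1 by (simp add: l2_norm_def L2_set_def)
  qed
  then obtain p q where pq: "p < M" "q < N" "T (p, q) \<noteq> 0" by auto
  define s where "s = l2_norm {..<M} (\<lambda>k. T (k, q))"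
  have "cmod (T (p, q)) \<le> s"
    unfolding s_def by (rule norm_le_l2_norm[where f = "\<lambda>k. T (k, q)"]) (use pq in auto)
  moreover have "0 < cmod (T (p, q))" using pq by simp
  ultimately have s: "s > 0" by linarith
  \<comment> \<open>The factors are column \<open>q\<close>, normalised, and row \<open>p\<close>,
    rescaled to match; the minors through the pivot \<open>T (p, q)\<close> give the
    factorisation.\<close>
  define U where "U = (\<lambda>k. complex_of_real (1 / s) * T (k, q))"
  define W where "W = (\<lambda>l. complex_of_real s * T (p, l) / T (p, q))"
  have UW: "U k * W l = T (k, l)" if "k < M" "l < N" for k l
    using minor[OF that(1) pq(1) that(2) pq(2)] s pq(3) by (simp add: U_def W_def field_simps)
  have U1: "l2_norm {..<M} U = 1"
    using s unfolding U_def l2_norm_scale s_def[symmetric] by (simp add: norm_divide)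
  have "l2_norm ?A (tensor U W) = l2_norm ?A T"
    by (rule l2_norm_cong) (auto simp: UW)
  then have W1: "l2_norm {..<N} W = 1"
    using T1 U1 by (simp add: l2_norm_tensor)
  obtain C where C: "geometric_error_constant M N C"
    using geometric_error_bound[OF assms(1,2)] by blast
  \<comment> \<open>Going down the first column and then along the last row meets every antidiagonal
    exactly once.\<close>
  define H where "H = (\<lambda>i. if i < M then T (i, 0) else T (M - 1, i - (M - 1)))"
  have H: "cmod (U k * W l - H (k + l)) \<le> 0" if "k < M" "l < N" for k l
    using that assms(1,2) hankel[of k "k + l" l 0] hankel[of k "M - 1" l "k + l - (M - 1)"]
    by (auto simp: UW H_def)
  obtain a b where gp: "geometric_pair M N a b" and Ua: "l2_norm {..<M} (\<lambda>k. U k - a k) \<le> C * 0"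
    and Wb: "l2_norm {..<N} (\<lambda>l. W l - b l) \<le> C * 0"
    by (rule geometric_error_constantE[OF C U1 W1 _ H]) auto
  have a: "a k = U k" if "k < M" for k
  proof -
    have "cmod (U k - a k) \<le> C * 0"
      by (rule order_trans[OF norm_le_l2_norm[where f = "\<lambda>k. U k - a k"] Ua]) (use that in auto)
    then show ?thesis by simp
  qed
  have b: "b l = W l" if "l < N" for l
  proof -
    have "cmod (W l - b l) \<le> C * 0"
      by (rule order_trans[OF norm_le_l2_norm[where f = "\<lambda>l. W l - b l"] Wb]) (use that in auto)
    then show ?thesis by simp
  qed
  have "l2_norm {..<M} a = 1" "l2_norm {..<N} b = 1"
    using U1 W1 l2_norm_cong[of "{..<M}" a U] l2_norm_cong[of "{..<N}" b W] a b by auto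
  from geometric_pair_unit[OF assms(1,2) gp this] show ?thesis
    by (simp add: rank1_hankel_form_def a b UW cong: conj_cong)
qed

section \<open>Summable steps and the limit of the iterates\<close>

lemma sqrt_ge_self: "0 \<le> t \<Longrightarrow> t \<le> 1 \<Longrightarrow> t \<le> sqrt t"
  by (rule real_le_rsqrt) (simp add: power2_eq_square mult_left_le)

lemma convergent_of_geometric_steps:
  fixes f :: "nat \<Rightarrow> complex"
  assumes "\<And>n. cmod (f (Suc n) - f n) \<le> K * r ^ n" "0 \<le> r" "r < 1"
  shows "convergent f"
proof -
  have "summable (\<lambda>n. K * r ^ n)"
    using assms by (intro summable_mult summable_geometric) auto
  then have "summable (\<lambda>n. f (Suc n) - f n)"
    by (rule summable_comparison_test') (use assms in auto)
  then have "convergent (\<lambda>n. \<Sum>i<n. f (Suc i) - f i)"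
    by (simp add: summable_iff_convergent)
  then have "convergent (\<lambda>n. f n - f 0)"
    by (simp add: sum_lessThan_telescope)
  then have "convergent (\<lambda>n. (f n - f 0) + f 0)"
    by (intro convergent_add convergent_const)
  then show ?thesis by simp
qed

text \<open>The run is divided at each stage by the current singular value, so its tensors have norm
  one and \<open>\<rho>\<close> is the ratio of consecutive singular values. Unit norm, vanishing
  minors and Hankel structure all pass to the limit and determine its form.\<close>

lemma normalised_cadzow_convergence:
  fixes U W :: "nat \<Rightarrow> nat \<Rightarrow> complex" and g :: "nat \<Rightarrow> nat \<times> nat \<Rightarrow> complex" and \<rho> :: "nat \<Rightarrow> real"
  assumes MN: "2 \<le> M" "2 \<le> N"
    and U1: "\<And>j. l2_norm {..<M} (U j) = 1" and W1: "\<And>j. l2_norm {..<N} (W j) = 1"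
    and P: "\<And>j. is_hankel_proj M N (tensor (U j) (W j)) (g j)"
    and L: "\<And>j. leading_pair M N (g j) (\<rho> j) (U (Suc j)) (W (Suc j))"
    and \<rho>: "\<rho> \<longlonglongrightarrow> 1"
  shows "\<exists>T. (\<forall>k<M. \<forall>l<N. (\<lambda>j. U j k * W j l) \<longlonglongrightarrow> T (k, l)) \<and>
    l2_norm ({..<M} \<times> {..<N}) T = 1 \<and>
    (\<forall>k<M. \<forall>k'<M. \<forall>l<N. \<forall>l'<N. k + l = k' + l' \<longrightarrow> T (k, l) = T (k', l')) \<and>
    (\<exists>c. cmod c = 1 \<and> rank1_hankel_form M N c T)"
proof -
  let ?A = "{..<M} \<times> {..<N}"
  define x where "x = (\<lambda>j. tensor (U j) (W j))"
  define \<delta> where "\<delta> = (\<lambda>j. (l2_norm ?A (\<lambda>p. tensor (U j) (W j) p - g j p))\<^sup>2)"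
  have d0: "0 \<le> \<delta> j" for j by (simp add: \<delta>_def)
  note bd = leading_pair_bounds[OF U1 W1 P L, OF fun_cong[OF \<delta>_def]]
  \<comment> \<open>Ratios near 1 leave no room for a defect, since \<open>\<rho>^2\<close> is at
    most \<open>1 - \<delta>\<close>.\<close>
  have dlim: "\<delta> \<longlonglongrightarrow> 0"
  proof (rule tendsto_sandwich[OF _ _ tendsto_const])
    show "\<forall>\<^sub>F j in sequentially. 0 \<le> \<delta> j" using d0 by simp
    show "\<forall>\<^sub>F j in sequentially. \<delta> j \<le> 1 - (\<rho> j)\<^sup>2"
      using bd(2) by (intro always_eventually allI) (simp add: le_diff_eq add.commute)
    show "(\<lambda>j. 1 - (\<rho> j)\<^sup>2) \<longlonglongrightarrow> 0"
      using tendsto_diff[OF tendsto_const[of 1] tendsto_power[OF \<rho>, of 2]] by simp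
  qed
  obtain C where C: "geometric_error_constant M N C"
    using geometric_error_bound[OF MN] by blast
  then have C1: "C \<ge> 1" by (simp add: geometric_error_constant_def)
  define D where "D = (1 + 3 * C)\<^sup>2"
  have D1: "D \<ge> 1" using C1 unfolding D_def by (intro one_le_power) auto
  define q where "q = 1 - 1 / (8 * D)"
  have q: "0 \<le> q" "q < 1" using D1 by (auto simp: q_def field_simps)
  \<comment> \<open>The smallness thresholds of \<open>cadzow_contraction\<close>; beyond
    \<open>J\<close> every step contracts by the same \<open>q\<close>.\<close>
  define \<delta>0 where "\<delta>0 = min (1 / (16 * D)) (1 / (16 * C ^ 4))"
  have "0 < \<delta>0" using D1 C1 by (simp add: \<delta>0_def)
  then have "\<forall>\<^sub>F j in sequentially. \<delta> j < \<delta>0"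
    by (rule order_tendstoD(2)[OF dlim])
  then obtain J where J: "\<And>j. j \<ge> J \<Longrightarrow> \<delta> j < \<delta>0"
    by (auto simp: eventually_sequentially)
  have contract: "\<delta> (Suc j) \<le> q * \<delta> j" if "j \<ge> J" for j
    using J[OF that] unfolding \<delta>_def[THEN fun_cong, of "Suc j"] q_def
    by (intro cadzow_contraction[OF C D_def U1 W1 P L P fun_cong[OF \<delta>_def]]) (auto simp: \<delta>0_def)
  have geo: "\<delta> (n + J) \<le> q ^ n * \<delta> J" for n
  proof (induction n)
    case (Suc n)
    have "\<delta> (Suc n + J) \<le> q * \<delta> (n + J)" using contract[of "n + J"] by simp
    also have "\<dots> \<le> q * (q ^ n * \<delta> J)" by (rule mult_left_mono[OF Suc q(1)])
    finally show ?case by simp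
  qed simp
  have conv: "convergent (\<lambda>j. x j p)" if p: "p \<in> ?A" for p
  proof -
    \<comment> \<open>A step has length at most \<open>2 * sqrt \<delta> + \<delta>\<close>, hence
      at most \<open>3 * sqrt \<delta>\<close> once \<open>\<delta>\<close> is at most 1; it decays
      with ratio \<open>sqrt q\<close>.\<close>
    have "cmod (x (Suc n + J) p - x (n + J) p) \<le> (3 * sqrt (\<delta> J)) * sqrt q ^ n" for n
    proof -
      have "1 / (16 * D) \<le> 1" using D1 by (simp add: field_simps)
      then have d1: "\<delta> (n + J) \<le> 1" using J[of "n + J"] by (simp add: \<delta>0_def)
      have "cmod (x (Suc n + J) p - x (n + J) p) \<le> l2_norm ?A (\<lambda>p. x (Suc n + J) p - x (n + J) p)"
        by (rule norm_le_l2_norm[where f = "\<lambda>p. x (Suc n + J) p - x (n + J) p"]) (use p in auto)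
      also have "\<dots> \<le> 2 * sqrt (\<delta> (n + J)) + \<delta> (n + J)"
        using leading_pair_move[OF U1 W1 P L fun_cong[OF \<delta>_def], of "n + J"] by (simp add: x_def)
      also have "\<dots> \<le> 2 * sqrt (\<delta> (n + J)) + sqrt (\<delta> (n + J))"
        using d0[of "n + J"] d1 by (simp add: sqrt_ge_self)
      also have "\<dots> = 3 * sqrt (\<delta> (n + J))" by simp
      also have "\<dots> \<le> 3 * sqrt (q ^ n * \<delta> J)"
        using geo[of n] by simp
      also have "\<dots> = (3 * sqrt (\<delta> J)) * sqrt q ^ n"
        by (simp add: real_sqrt_mult real_sqrt_power)
      finally show ?thesis .
    qed
    then have "convergent (\<lambda>n. x (n + J) p)"
      using q by (intro convergent_of_geometric_steps[where r = "sqrt q"]) (auto simp: real_sqrt_lt_1_iff)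
    then show ?thesis
      by (simp only: convergent_ignore_initial_segment[of "\<lambda>j. x j p"])
  qed
  define T where "T = (\<lambda>p. lim (\<lambda>j. x j p))"
  have lim: "(\<lambda>j. x j p) \<longlonglongrightarrow> T p" if "p \<in> ?A" for p
    using conv[OF that] by (simp add: T_def convergent_LIMSEQ_iff)
  have limUW: "(\<lambda>j. U j k * W j l) \<longlonglongrightarrow> T (k, l)" if "k < M" "l < N" for k l
    using lim[of "(k, l)"] that by (simp add: x_def)
  have "(\<lambda>j. l2_norm ?A (x j)) \<longlonglongrightarrow> l2_norm ?A T"
    unfolding l2_norm_def L2_set_def
    by (intro tendsto_real_sqrt tendsto_sum tendsto_power tendsto_norm lim)
  then have T1: "l2_norm ?A T = 1"
    using U1 W1 by (simp add: x_def l2_norm_tensor LIMSEQ_const_iff)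
  have minor: "T (k, l) * T (k', l') = T (k, l') * T (k', l)"
    if "k < M" "k' < M" "l < N" "l' < N" for k k' l l'
  proof (rule LIMSEQ_unique)
    show "(\<lambda>j. (U j k * W j l) * (U j k' * W j l')) \<longlonglongrightarrow> T (k, l) * T (k', l')"
      using that by (intro tendsto_mult limUW)
    have "(\<lambda>j. (U j k * W j l') * (U j k' * W j l)) \<longlonglongrightarrow> T (k, l') * T (k', l)"
      using that by (intro tendsto_mult limUW)
    then show "(\<lambda>j. (U j k * W j l) * (U j k' * W j l')) \<longlonglongrightarrow> T (k, l') * T (k', l)"
      by (simp add: mult_ac)
  qed
  \<comment> \<open>The iterates need not be Hankel, but the projections \<open>g j\<close> are, and
    they share the limit because their distance from \<open>x j\<close> is
    \<open>sqrt (\<delta> j)\<close>.\<close>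
  have glim: "(\<lambda>j. g j p) \<longlonglongrightarrow> T p" if p: "p \<in> ?A" for p
  proof -
    have "(\<lambda>j. x j p - g j p) \<longlonglongrightarrow> 0"
    proof (rule Lim_null_comparison)
      show "(\<lambda>j. sqrt (\<delta> j)) \<longlonglongrightarrow> 0" using tendsto_real_sqrt[OF dlim] by simp
      show "\<forall>\<^sub>F j in sequentially. norm (x j p - g j p) \<le> sqrt (\<delta> j)"
        using p norm_le_l2_norm[of ?A p "\<lambda>p. x j p - g j p" for j] by (simp add: \<delta>_def x_def)
    qed
    from tendsto_diff[OF lim[OF p] this] show ?thesis by simp
  qed
  have hankel: "T (k, l) = T (k', l')"
    if "k < M" "k' < M" "l < N" "l' < N" "k + l = k' + l'" for k k' l l'
  proof (rule LIMSEQ_unique)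
    show "(\<lambda>j. g j (k, l)) \<longlonglongrightarrow> T (k, l)" using that by (intro glim) auto
    have "g j (k, l) = g j (k', l')" for j
      using P[of j] that(5) by (auto simp: is_hankel_proj_def hankel_fun_def)
    then show "(\<lambda>j. g j (k, l)) \<longlonglongrightarrow> T (k', l')" using that glim[of "(k', l')"] by simp
  qed
  show ?thesis
  proof (intro exI[of _ T] conjI)
    show "\<forall>k<M. \<forall>l<N. (\<lambda>j. U j k * W j l) \<longlonglongrightarrow> T (k, l)"
      using limUW by blast
    show "\<forall>k<M. \<forall>k'<M. \<forall>l<N. \<forall>l'<N. k + l = k' + l' \<longrightarrow> T (k, l) = T (k', l')"
      using hankel by blast
  qed (rule T1, rule unit_rank1_hankel[OF MN T1 minor hankel], assumption+)
qed

section \<open>Singular value decompositions and matrices\<close>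

lemma dim_mat_adjoint [simp]: "dim_row (mat_adjoint A) = dim_col A" "dim_col (mat_adjoint A) = dim_row A"
  by (simp_all add: mat_adjoint_def)

lemma index_mat_adjoint [simp]:
  fixes A :: "complex mat"
  assumes "i < dim_col A" "j < dim_row A"
  shows "mat_adjoint A $$ (i, j) = cnj (A $$ (j, i))"
  using assms by (simp add: mat_adjoint_def mat_of_rows_def conjugate_complex_def)

lemma index_times_mat:
  "A \<in> carrier_mat n m \<Longrightarrow> B \<in> carrier_mat m k \<Longrightarrow> i < n \<Longrightarrow> j < k \<Longrightarrow>
    (A * B) $$ (i, j) = (\<Sum>l<m. A $$ (i, l) * B $$ (l, j))"
  by (auto simp: scalar_prod_def lessThan_atLeast0 intro!: sum.cong)

text \<open>\<open>unitary_mat\<close> gives orthonormal columns; for a square matrix the left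
  inverse is also a right inverse, which gives the rows.\<close>

lemma unitary_mat_orthonormal:
  assumes "unitary_mat n U"
  shows "i < n \<Longrightarrow> j < n \<Longrightarrow> (\<Sum>k<n. cnj (U $$ (k, i)) * U $$ (k, j)) = (if i = j then 1 else 0)"
    and "i < n \<Longrightarrow> j < n \<Longrightarrow> (\<Sum>k<n. U $$ (i, k) * cnj (U $$ (j, k))) = (if i = j then 1 else 0)"
proof -
  have U: "U \<in> carrier_mat n n" and UU: "mat_adjoint U * U = 1\<^sub>m n"
    using assms by (auto simp: unitary_mat_def)
  have U': "mat_adjoint U \<in> carrier_mat n n" using U by auto
  have UU': "U * mat_adjoint U = 1\<^sub>m n"
    by (rule mat_mult_left_right_inverse[OF U' U UU])
  show "(\<Sum>k<n. cnj (U $$ (k, i)) * U $$ (k, j)) = (if i = j then 1 else 0)" if "i < n" "j < n"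
  proof -
    have "(\<Sum>k<n. cnj (U $$ (k, i)) * U $$ (k, j)) = (mat_adjoint U * U) $$ (i, j)"
      by (subst index_times_mat[OF U' U]) (use that U in auto)
    then show ?thesis using that by (simp add: UU)
  qed
  show "(\<Sum>k<n. U $$ (i, k) * cnj (U $$ (j, k))) = (if i = j then 1 else 0)" if "i < n" "j < n"
  proof -
    have "(\<Sum>k<n. U $$ (i, k) * cnj (U $$ (j, k))) = (U * mat_adjoint U) $$ (i, j)"
      by (subst index_times_mat[OF U U']) (use that U in auto)
    then show ?thesis using that by (simp add: UU')
  qed
qed

text \<open>Expanding the square and summing over \<open>i\<close> first leaves only the diagonal
  terms.\<close>

lemma parseval_rows:
  fixes Q :: "nat \<Rightarrow> nat \<Rightarrow> complex"
  assumes "\<And>k k'. k < n \<Longrightarrow> k' < n \<Longrightarrow> (\<Sum>i<n. Q k i * cnj (Q k' i)) = (if k = k' then 1 else 0)"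
  shows "l2_norm {..<n} (\<lambda>i. \<Sum>k<n. a k * Q k i) = l2_norm {..<n} a"
proof -
  have "complex_of_real (\<Sum>i<n. (cmod (\<Sum>k<n. a k * Q k i))\<^sup>2)
      = (\<Sum>i<n. \<Sum>k<n. \<Sum>k'<n. (a k * cnj (a k')) * (Q k i * cnj (Q k' i)))"
    by (simp only: of_real_sum complex_norm_square cnj_sum sum_product complex_cnj_mult mult_ac)
  also have "\<dots> = (\<Sum>k<n. \<Sum>i<n. \<Sum>k'<n. (a k * cnj (a k')) * (Q k i * cnj (Q k' i)))"
    by (rule sum.swap)
  also have "\<dots> = (\<Sum>k<n. \<Sum>k'<n. \<Sum>i<n. (a k * cnj (a k')) * (Q k i * cnj (Q k' i)))"
    by (rule sum.cong[OF refl], rule sum.swap)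
  also have "\<dots> = (\<Sum>k<n. \<Sum>k'<n. if k = k' then a k * cnj (a k') else 0)"
    unfolding sum_distrib_left[symmetric]
    by (intro sum.cong refl) (simp add: assms)
  also have "\<dots> = complex_of_real (\<Sum>k<n. (cmod (a k))\<^sup>2)"
    by (simp only: sum.delta sum.delta' finite_lessThan of_real_sum complex_norm_square)
      (simp add: sum.delta)
  finally have "(l2_norm {..<n} (\<lambda>i. \<Sum>k<n. a k * Q k i))\<^sup>2 = (l2_norm {..<n} a)\<^sup>2"
    unfolding l2_norm_sq of_real_eq_iff .
  then show ?thesis by (simp add: power2_eq_iff_nonneg)
qed

lemma is_svd_entry:
  assumes "is_svd A U s V" "A \<in> carrier_mat M N" "k < M" "l < N"
  shows "A $$ (k, l) = (\<Sum>i<min M N. complex_of_real (s i) * (U $$ (k, i) * cnj (V $$ (l, i))))"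
proof -
  let ?S = "mat M N (\<lambda>(i, j). if i = j then complex_of_real (s i) else 0)"
  have U: "U \<in> carrier_mat M M" and V: "V \<in> carrier_mat N N"
    and A: "A = U * ?S * mat_adjoint V"
    using assms by (auto simp: is_svd_def unitary_mat_def)
  have V': "mat_adjoint V \<in> carrier_mat N N" using V by auto
  have US: "(U * ?S) $$ (k, j) = (if j < M then U $$ (k, j) * complex_of_real (s j) else 0)" if "j < N" for j
  proof -
    have "(U * ?S) $$ (k, j) = (\<Sum>i<M. U $$ (k, i) * ?S $$ (i, j))"
      by (rule index_times_mat[OF U _ assms(3) that]) simp
    also have "\<dots> = (\<Sum>i<M. if i = j then U $$ (k, i) * complex_of_real (s i) else 0)"
      using that by (intro sum.cong) auto
    finally show ?thesis by (simp add: sum.delta)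
  qed
  have "A $$ (k, l) = (\<Sum>j<N. (U * ?S) $$ (k, j) * cnj (V $$ (l, j)))"
    unfolding A using assms(3,4) U V by (subst index_times_mat[OF _ V']) auto
  also have "\<dots> = (\<Sum>j<N. if j < M then complex_of_real (s j) * (U $$ (k, j) * cnj (V $$ (l, j))) else 0)"
    by (rule sum.cong) (auto simp: US)
  also have "\<dots> = (\<Sum>j\<in>{..<N} \<inter> {j. j < M}. complex_of_real (s j) * (U $$ (k, j) * cnj (V $$ (l, j))))"
    by (simp add: sum.inter_restrict)
  also have "{..<N} \<inter> {j. j < M} = {..<min M N}" by auto
  finally show ?thesis .
qed

text \<open>In the coordinates given by the singular vectors the form is the real part of the sum of
  \<open>s i * \<alpha> i * \<beta> i\<close>. The coordinate vectors keep norm one, so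
  Cauchy-Schwarz applies.\<close>

lemma singular_value_bound:
  assumes svd: "is_svd A U s V" and A: "A \<in> carrier_mat M N" and "0 < M" "0 < N"
    and a: "l2_norm {..<M} a = 1" and b: "l2_norm {..<N} b = 1"
  shows "l2_inner ({..<M} \<times> {..<N}) (tensor a b) (\<lambda>p. A $$ p) \<le> s 0"
proof -
  let ?m = "min M N"
  have U: "unitary_mat M U" and V: "unitary_mat N V" and s0: "\<And>i. i < ?m \<Longrightarrow> 0 \<le> s i"
    and smax: "\<And>i. i < ?m \<Longrightarrow> s i \<le> s 0"
    using svd A by (auto simp: is_svd_def)
  define \<alpha> where "\<alpha> = (\<lambda>i. \<Sum>k<M. a k * cnj (U $$ (k, i)))"
  define \<beta> where "\<beta> = (\<lambda>i. \<Sum>l<N. b l * V $$ (l, i))"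
  have \<alpha>1: "l2_norm {..<M} \<alpha> = 1"
    unfolding \<alpha>_def a[symmetric]
  proof (rule parseval_rows)
    fix k k' assume "k < M" "k' < M"
    then show "(\<Sum>i<M. cnj (U $$ (k, i)) * cnj (cnj (U $$ (k', i)))) = (if k = k' then 1 else 0)"
      using unitary_mat_orthonormal(2)[OF U, of k' k] by (auto simp: mult.commute)
  qed
  have \<beta>1: "l2_norm {..<N} \<beta> = 1"
    unfolding \<beta>_def b[symmetric]
    by (rule parseval_rows) (rule unitary_mat_orthonormal(2)[OF V])
  have "l2_inner ({..<M} \<times> {..<N}) (tensor a b) (\<lambda>p. A $$ p)
      = Re (\<Sum>k<M. \<Sum>l<N. a k * b l * cnj (A $$ (k, l)))"
    by (simp add: l2_inner_def sum.cartesian_product tensor_def case_prod_beta inner_complex_def Re_sum)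
  also have "(\<Sum>k<M. \<Sum>l<N. a k * b l * cnj (A $$ (k, l)))
      = (\<Sum>k<M. \<Sum>l<N. \<Sum>i<?m. complex_of_real (s i) * ((a k * cnj (U $$ (k, i))) * (b l * V $$ (l, i))))"
    by (intro sum.cong refl) (simp add: is_svd_entry[OF svd A] sum_distrib_left mult_ac)
  also have "\<dots> = (\<Sum>k<M. \<Sum>i<?m. \<Sum>l<N. complex_of_real (s i) * ((a k * cnj (U $$ (k, i))) * (b l * V $$ (l, i))))"
    by (rule sum.cong[OF refl], rule sum.swap)
  also have "\<dots> = (\<Sum>i<?m. \<Sum>k<M. \<Sum>l<N. complex_of_real (s i) * ((a k * cnj (U $$ (k, i))) * (b l * V $$ (l, i))))"
    by (rule sum.swap)
  also have "\<dots> = (\<Sum>i<?m. complex_of_real (s i) * (\<alpha> i * \<beta> i))"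
    unfolding \<alpha>_def \<beta>_def sum_product by (simp only: sum_distrib_left)
  also have "Re \<dots> \<le> cmod \<dots>" by (rule complex_Re_le_cmod)
  also have "\<dots> \<le> (\<Sum>i<?m. s 0 * (\<bar>cmod (\<alpha> i)\<bar> * \<bar>cmod (\<beta> i)\<bar>))"
    by (rule order_trans[OF norm_sum sum_mono])
      (auto simp: norm_mult s0 intro!: mult_right_mono smax)
  also have "\<dots> = s 0 * (\<Sum>i<?m. \<bar>cmod (\<alpha> i)\<bar> * \<bar>cmod (\<beta> i)\<bar>)"
    by (simp only: sum_distrib_left)
  also have "\<dots> \<le> s 0 * (L2_set (\<lambda>i. cmod (\<alpha> i)) {..<?m} * L2_set (\<lambda>i. cmod (\<beta> i)) {..<?m})"
    using s0[of 0] \<open>0 < M\<close> \<open>0 < N\<close> by (intro mult_left_mono L2_set_mult_ineq) auto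
  also have "\<dots> \<le> s 0 * (l2_norm {..<M} \<alpha> * l2_norm {..<N} \<beta>)"
    using s0[of 0] \<open>0 < M\<close> \<open>0 < N\<close> unfolding l2_norm_def
    by (intro mult_left_mono mult_mono) (auto simp: L2_set_def intro!: sum_mono2 sum_nonneg)
  finally show ?thesis by (simp add: \<alpha>1 \<beta>1)
qed

text \<open>The second factor is conjugated because the rank-one matrix is u v^*. Orthogonality to
  the tangent space comes from the singular vector equations, u^* A = \<sigma> v^* in
  \<open>left\<close> and A v = \<sigma> u in \<open>right\<close>; maximality is
  \<open>singular_value_bound\<close>.\<close>

lemma leading_singular_triple_pair:
  assumes lst: "leading_singular_triple A \<sigma> u v" and A: "A \<in> carrier_mat M N" and "0 < M" "0 < N"
  shows "dim_vec u = M" "dim_vec v = N" "0 \<le> \<sigma>"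
    "leading_pair M N (\<lambda>p. A $$ p) \<sigma> (\<lambda>k. u $ k) (\<lambda>l. cnj (v $ l))"
proof -
  obtain U s V where svd: "is_svd A U s V" and \<sigma>: "\<sigma> = s 0" and u: "u = col U 0" and v: "v = col V 0"
    using lst unfolding leading_singular_triple_def by blast
  let ?m = "min M N"
  have U: "unitary_mat M U" and V: "unitary_mat N V" and s0: "0 \<le> s 0"
    using svd A \<open>0 < M\<close> \<open>0 < N\<close> by (auto simp: is_svd_def)
  have Uc: "U \<in> carrier_mat M M" and Vc: "V \<in> carrier_mat N N"
    using U V by (auto simp: unitary_mat_def)
  show "dim_vec u = M" "dim_vec v = N" "0 \<le> \<sigma>"
    using Uc Vc s0 by (auto simp: u v \<sigma>)
  have uk: "u $ k = U $$ (k, 0)" if "k < M" for k using that Uc \<open>0 < M\<close> by (simp add: u)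
  have vl: "v $ l = V $$ (l, 0)" if "l < N" for l using that Vc \<open>0 < N\<close> by (simp add: v)
  have unit: "l2_norm {..<n} f = 1" if "(\<Sum>k<n. cnj (f k) * f k) = 1" for n f
  proof -
    have "complex_of_real ((l2_norm {..<n} f)\<^sup>2) = (\<Sum>k<n. cnj (f k) * f k)"
      unfolding l2_norm_sq of_real_sum complex_norm_square by (simp only: mult.commute)
    with that have "(l2_norm {..<n} f)\<^sup>2 = 1" by (metis of_real_eq_1_iff)
    then show ?thesis using l2_norm_nonneg[of "{..<n}" f] by (simp add: power2_eq_1_iff)
  qed
  have "(\<Sum>k<M. cnj (u $ k) * u $ k) = 1"
    using unitary_mat_orthonormal(1)[OF U, of 0 0] \<open>0 < M\<close> by (simp add: uk)
  then have u1: "l2_norm {..<M} (\<lambda>k. u $ k) = 1" by (rule unit)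
  have "(\<Sum>l<N. cnj (v $ l) * v $ l) = 1"
    using unitary_mat_orthonormal(1)[OF V, of 0 0] \<open>0 < N\<close> by (simp add: vl)
  then have v1: "l2_norm {..<N} (\<lambda>l. cnj (v $ l)) = 1" by (intro unit) (simp add: mult.commute)
  have left: "(\<Sum>k<M. A $$ (k, l) * cnj (u $ k)) = complex_of_real \<sigma> * cnj (v $ l)" if l: "l < N" for l
  proof -
    have "(\<Sum>k<M. A $$ (k, l) * cnj (u $ k))
        = (\<Sum>k<M. \<Sum>i<?m. (complex_of_real (s i) * cnj (V $$ (l, i))) * (cnj (U $$ (k, 0)) * U $$ (k, i)))"
      by (intro sum.cong refl) (simp add: is_svd_entry[OF svd A _ l] uk sum_distrib_left sum_distrib_right mult_ac)
    also have "\<dots> = (\<Sum>i<?m. (complex_of_real (s i) * cnj (V $$ (l, i))) * (\<Sum>k<M. cnj (U $$ (k, 0)) * U $$ (k, i)))"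
      by (subst sum.swap) (simp only: sum_distrib_left)
    also have "\<dots> = (\<Sum>i<?m. if i = 0 then complex_of_real (s i) * cnj (V $$ (l, i)) else 0)"
      using \<open>0 < M\<close> by (intro sum.cong refl) (simp add: unitary_mat_orthonormal(1)[OF U])
    finally show ?thesis using \<open>0 < M\<close> \<open>0 < N\<close> l by (simp add: sum.delta \<sigma> vl)
  qed
  have right: "(\<Sum>l<N. A $$ (k, l) * v $ l) = complex_of_real \<sigma> * u $ k" if k: "k < M" for k
  proof -
    have "(\<Sum>l<N. A $$ (k, l) * v $ l)
        = (\<Sum>l<N. \<Sum>i<?m. (complex_of_real (s i) * U $$ (k, i)) * (cnj (V $$ (l, i)) * V $$ (l, 0)))"
      by (intro sum.cong refl) (simp add: is_svd_entry[OF svd A k] vl sum_distrib_left sum_distrib_right mult_ac)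
    also have "\<dots> = (\<Sum>i<?m. (complex_of_real (s i) * U $$ (k, i)) * (\<Sum>l<N. cnj (V $$ (l, i)) * V $$ (l, 0)))"
      by (subst sum.swap) (simp only: sum_distrib_left)
    also have "\<dots> = (\<Sum>i<?m. if i = 0 then complex_of_real (s i) * U $$ (k, i) else 0)"
      using \<open>0 < N\<close> by (intro sum.cong refl) (simp add: unitary_mat_orthonormal(1)[OF V])
    finally show ?thesis using \<open>0 < M\<close> \<open>0 < N\<close> k by (simp add: sum.delta \<sigma> uk)
  qed
  have norm1: "(\<Sum>k<n. f k * cnj (f k)) = 1" if "l2_norm {..<n} f = 1" for n f
  proof -
    have "complex_of_real ((l2_norm {..<n} f)\<^sup>2) = (\<Sum>k<n. f k * cnj (f k))"
      unfolding l2_norm_sq of_real_sum complex_norm_square ..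
    with that show ?thesis by simp
  qed
  let ?W = "\<lambda>l. cnj (v $ l)"
  let ?r = "\<lambda>p. A $$ p - complex_of_real \<sigma> * tensor (\<lambda>k. u $ k) ?W p"
  have "l2_inner ({..<M} \<times> {..<N}) ?r (tensor (\<lambda>k. u $ k) c) = 0" for c
  proof -
    have "(\<Sum>k<M. ?r (k, l) * cnj (u $ k)) = 0" if "l < N" for l
    proof -
      have "(\<Sum>k<M. ?r (k, l) * cnj (u $ k))
          = (\<Sum>k<M. A $$ (k, l) * cnj (u $ k)) - (complex_of_real \<sigma> * ?W l) * (\<Sum>k<M. u $ k * cnj (u $ k))"
        by (simp add: sum_subtractf sum_distrib_left algebra_simps)
      then show ?thesis by (simp add: left[OF that] norm1[OF u1])
    qed
    then show ?thesis by (simp add: l2_inner_tensor_right)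
  qed
  moreover have "l2_inner ({..<M} \<times> {..<N}) ?r (tensor c ?W) = 0" for c
  proof -
    have "(\<Sum>l<N. ?r (k, l) * cnj (?W l)) = 0" if "k < M" for k
    proof -
      have "(\<Sum>l<N. ?r (k, l) * cnj (?W l))
          = (\<Sum>l<N. A $$ (k, l) * v $ l) - (complex_of_real \<sigma> * u $ k) * (\<Sum>l<N. ?W l * cnj (?W l))"
        by (simp add: sum_subtractf sum_distrib_left algebra_simps)
      then show ?thesis by (simp add: right[OF that] norm1[OF v1] del: complex_cnj_cnj)
    qed
    then show ?thesis by (simp add: l2_inner_tensor_right')
  qed
  ultimately show "leading_pair M N (\<lambda>p. A $$ p) \<sigma> (\<lambda>k. u $ k) ?W"
    unfolding leading_pair_def \<sigma>
    using u1 v1 singular_value_bound[OF svd A \<open>0 < M\<close> \<open>0 < N\<close>] by (simp add: \<sigma>)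
qed

text \<open>On each antidiagonal the deviations from the average sum to zero while a Hankel function
  is constant, so the inner product vanishes antidiagonal by antidiagonal.\<close>

lemma is_hankel_proj_average:
  assumes "\<And>k l. k < M \<Longrightarrow> l < N \<Longrightarrow> x (k, l) = B $$ (k, l)"
  shows "is_hankel_proj M N x (\<lambda>(k, l).
    (\<Sum>p \<in> antidiagonal M N (k + l). B $$ p) / of_nat (card (antidiagonal M N (k + l))))"
proof -
  define h where "h = (\<lambda>i. (\<Sum>p \<in> antidiagonal M N i. B $$ p) / of_nat (card (antidiagonal M N i)) :: complex)"
  let ?A = "{..<M} \<times> {..<N}"
  have "l2_inner ?A (\<lambda>p. x p - (\<lambda>(k, l). h (k + l)) p) f = 0" if f: "hankel_fun f" for f
  proof -
    obtain h' where h': "f = (\<lambda>(k, l). h' (k + l))"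
      using f by (auto simp: hankel_fun_def)
    let ?s = "\<lambda>p. fst p + snd p"
    have fib: "{p \<in> ?A. ?s p = i} = antidiagonal M N i" for i
      by (auto simp: antidiagonal_def)
    have fin: "finite (antidiagonal M N i)" for i
      unfolding fib[symmetric] by simp
    have "l2_inner ?A (\<lambda>p. x p - (\<lambda>(k, l). h (k + l)) p) f
        = (\<Sum>p\<in>?A. inner (B $$ p - h (?s p)) (h' (?s p)))"
      unfolding l2_inner_def h' by (rule sum.cong) (auto simp: assms)
    also have "\<dots> = (\<Sum>i\<in>?s ` ?A. \<Sum>p\<in>{p \<in> ?A. ?s p = i}. inner (B $$ p - h (?s p)) (h' (?s p)))"
      by (rule sum.image_gen) simp
    also have "\<dots> = (\<Sum>i\<in>?s ` ?A. inner (\<Sum>p\<in>antidiagonal M N i. B $$ p - h i) (h' i))"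
      unfolding inner_sum_left fib[symmetric] by (intro sum.cong refl) auto
    also have "\<dots> = 0"
    proof (rule sum.neutral, rule ballI)
      \<comment> \<open>Only antidiagonals that meet the grid occur, so the average divides by a
        nonzero number.\<close>
      fix i assume "i \<in> ?s ` ?A"
      then have "antidiagonal M N i \<noteq> {}" unfolding fib[symmetric] by auto
      then have "card (antidiagonal M N i) \<noteq> 0" using fin by simp
      then have "(\<Sum>p\<in>antidiagonal M N i. B $$ p - h i) = 0"
        by (simp add: sum_subtractf h_def)
      then show "inner (\<Sum>p\<in>antidiagonal M N i. B $$ p - h i) (h' i) = 0" by simp
    qed
    finally show ?thesis .
  qed
  moreover have "hankel_fun (\<lambda>(k, l). h (k + l))"
    unfolding hankel_fun_def by blast
  ultimately show ?thesis
    unfolding is_hankel_proj_def h_def by blast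
qed

section \<open>Limits and ranks of matrices\<close>

lemma mat_LIMSEQ_entrywise:
  assumes "\<And>j. X j \<in> carrier_mat M N" "L \<in> carrier_mat M N"
    and "\<And>k l. k < M \<Longrightarrow> l < N \<Longrightarrow> (\<lambda>j. X j $$ (k, l)) \<longlonglongrightarrow> L $$ (k, l)"
  shows "mat_LIMSEQ X L"
proof -
  have "frobenius_norm (X j - L) = sqrt (\<Sum>k<M. \<Sum>l<N. (cmod (X j $$ (k, l) - L $$ (k, l)))\<^sup>2)" for j
    using assms(1)[of j] assms(2) by (auto simp: frobenius_norm_def intro!: sum.cong)
  moreover have "(\<lambda>j. sqrt (\<Sum>k<M. \<Sum>l<N. (cmod (X j $$ (k, l) - L $$ (k, l)))\<^sup>2))
      \<longlonglongrightarrow> sqrt (\<Sum>k<M. \<Sum>l<N. (cmod (L $$ (k, l) - L $$ (k, l)))\<^sup>2)"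
    using assms(3)
    by (intro tendsto_real_sqrt tendsto_sum tendsto_power tendsto_norm tendsto_diff tendsto_const) auto
  ultimately show ?thesis
    using assms(1,2) by (auto simp: mat_LIMSEQ_def)
qed

text \<open>The product form bounds the rank from above, a nonzero column from below.\<close>

lemma rank_one_rank:
  fixes L :: "complex mat"
  assumes L: "L \<in> carrier_mat M N" and prod: "\<And>k l. k < M \<Longrightarrow> l < N \<Longrightarrow> L $$ (k, l) = f k * g l"
    and nz: "p < M" "q < N" "L $$ (p, q) \<noteq> 0"
  shows "vec_space.rank M L = 1"
proof -
  interpret vec_space "TYPE(complex)" M .
  have "rank L \<le> 1"
    by (rule rank_le_1_product_entries[OF L, where f = f and g = g]) (use L prod in auto)
  moreover have "card {col L q} \<le> rank L"
  proof (rule rank_ge_card_indpt[OF L])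
    show "{col L q} \<subseteq> set (cols L)" using L nz(2) by (auto simp: cols_def)
    have "col L q \<in> carrier_vec M" using L nz(2) by auto
    moreover have "col L q \<noteq> 0\<^sub>v M"
    proof
      assume "col L q = 0\<^sub>v M"
      then have "col L q $ p = 0" using nz(1) by simp
      then show False using L nz by simp
    qed
    ultimately show "lin_indpt {col L q}"
      by (subst lindep_span) (auto simp: span_empty)
  qed
  ultimately show ?thesis by simp
qed

section \<open>Translation of a Cadzow run into normalised tensors\<close>

theorem theorem5p5:
  fixes M N :: nat and A :: "complex mat"
    and \<sigma> :: "nat \<Rightarrow> real" and u v :: "nat \<Rightarrow> complex vec"
  assumes "2 \<le> M" and "M \<le> N"
    and "A \<in> carrier_mat M N"
    and "vec_space.rank M A \<ge> 1"
    and "simple_largest_singular_value A"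
    and "cadzow_run A \<sigma> u v"
  shows "\<exists>s. \<sigma> \<longlonglongrightarrow> s \<and>
     (s = 0 \<longrightarrow> mat_LIMSEQ (\<lambda>j. rank1_term (\<sigma> j) (u j) (v j)) (0\<^sub>m M N)) \<and>
     (s > 0 \<longrightarrow>
        (\<exists>L. mat_LIMSEQ (\<lambda>j. outer_prod (u j) (conjugate (v j))) L \<and>
             (\<exists>c. cmod c = 1 \<and>
                ((\<exists>z. L = c \<cdot>\<^sub>m outer_prod (z_vec M z) (z_vec N z)) \<or>
                 L = c \<cdot>\<^sub>m outer_prod (e_vec M) (e_vec N))) \<and>
             mat_LIMSEQ (\<lambda>j. rank1_term (\<sigma> j) (u j) (v j)) (complex_of_real s \<cdot>\<^sub>m L) \<and>
             hankel_mat (complex_of_real s \<cdot>\<^sub>m L) \<and>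
             vec_space.rank M (complex_of_real s \<cdot>\<^sub>m L) = 1))"
proof -
  let ?I = "{..<M} \<times> {..<N}"
  have MN: "2 \<le> M" "2 \<le> N" "0 < M" "0 < N" using assms(1,2) by auto
  define X where "X = (\<lambda>j. rank1_term (\<sigma> j) (u j) (v j))"
  \<comment> \<open>\<open>B j\<close> is the matrix whose leading triple is taken at stage
    \<open>j\<close>, so that the input and the projections are treated alike.\<close>
  define B where "B = (\<lambda>j. case j of 0 \<Rightarrow> A | Suc i \<Rightarrow> hankel_proj (X i))"
  have triple: "leading_singular_triple (B j) (\<sigma> j) (u j) (v j)" for j
    using assms(6) by (cases j) (auto simp: cadzow_run_def B_def X_def)
  have dim_X: "X j \<in> carrier_mat (dim_vec (u j)) (dim_vec (v j))" for j
    by (rule carrier_matI) (simp_all add: X_def rank1_term_def outer_prod_def)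
  \<comment> \<open>The dimensions of \<open>u j\<close> and \<open>v j\<close> are known only
    through those of \<open>B j\<close>, hence the induction.\<close>
  have carrier_B: "B j \<in> carrier_mat M N" for j
  proof (induction j)
    case 0
    then show ?case using assms(3) by (simp add: B_def)
  next
    case (Suc j)
    from leading_singular_triple_pair(1,2)[OF triple Suc MN(3,4)] dim_X[of j]
    show ?case by (auto simp: B_def hankel_proj_def)
  qed
  note pair = leading_singular_triple_pair[OF triple carrier_B MN(3,4)]
  have carrier_X: "X j \<in> carrier_mat M N" for j
    using dim_X[of j] pair(1,2)[of j] by simp
  define U where "U = (\<lambda>j k. u j $ k)"
  define W where "W = (\<lambda>j l. cnj (v j $ l))"
  have lead: "leading_pair M N (\<lambda>p. B j $$ p) (\<sigma> j) (U j) (W j)" for j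
    unfolding U_def W_def by (rule pair(4))
  have U1: "l2_norm {..<M} (U j) = 1" and W1: "l2_norm {..<N} (W j) = 1" for j
    using lead[of j] by (simp_all add: leading_pair_def)
  have outer: "outer_prod (u j) (conjugate (v j)) \<in> carrier_mat M N" for j
    by (rule carrier_matI) (simp_all add: outer_prod_def pair(1,2))
  have outer_entry: "outer_prod (u j) (conjugate (v j)) $$ (k, l) = U j k * W j l" if "k < M" "l < N" for j k l
    using that by (simp add: outer_prod_def pair(1,2) U_def W_def conjugate_complex_def)
  have X_entry: "X j $$ (k, l) = complex_of_real (\<sigma> j) * (U j k * W j l)" if "k < M" "l < N" for j k l
    unfolding X_def rank1_term_def using that outer[of j] by (simp add: outer_entry)
  \<comment> \<open>The averages continued to all index pairs, as \<open>hankel_fun\<close> demands.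
    \<open>G j\<close> agrees with \<open>B (Suc j)\<close> on the grid, which suffices for
    \<open>leading_pair_cong\<close>.\<close>
  define G where "G = (\<lambda>j (k, l). (\<Sum>p \<in> antidiagonal M N (k + l). X j $$ p)
    / of_nat (card (antidiagonal M N (k + l))))"
  have proj: "is_hankel_proj M N (\<lambda>p. complex_of_real (\<sigma> j) * tensor (U j) (W j) p) (G j)" for j
    unfolding G_def by (rule is_hankel_proj_average) (simp add: X_entry)
  have leadG: "leading_pair M N (G j) (\<sigma> (Suc j)) (U (Suc j)) (W (Suc j))" for j
    by (rule leading_pair_cong[OF _ lead])
      (use carrier_X[of j] in \<open>auto simp: B_def hankel_proj_def G_def\<close>)
  \<comment> \<open>The spectral norm is at most the Frobenius norm, the projection does not
    increase the latter, and for a rank-one matrix the two agree.\<close>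
  have decr: "\<sigma> (Suc j) \<le> \<sigma> j" for j
  proof -
    have "\<sigma> (Suc j) \<le> l2_norm ?I (G j)" by (rule leading_pair_le_norm[OF leadG])
    also have "\<dots> \<le> l2_norm ?I (\<lambda>p. complex_of_real (\<sigma> j) * tensor (U j) (W j) p)"
      by (rule is_hankel_proj_norm_le[OF proj])
    also have "\<dots> = \<sigma> j"
      using pair(3)[of j] U1 W1 by (simp add: l2_norm_scale l2_norm_tensor)
    finally show ?thesis .
  qed
  obtain s where s: "\<sigma> \<longlonglongrightarrow> s" and s_le: "\<And>j. s \<le> \<sigma> j"
    using decseq_convergent[of \<sigma> 0] pair(3) decr by (auto simp: decseq_Suc_iff)
  have "mat_LIMSEQ X (0\<^sub>m M N)" if "s = 0"
  proof (rule mat_LIMSEQ_entrywise[OF carrier_X])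
    fix k l assume kl: "k < M" "l < N"
    have "(\<lambda>j. X j $$ (k, l)) \<longlonglongrightarrow> 0"
    proof (rule Lim_null_comparison)
      show "\<sigma> \<longlonglongrightarrow> 0" using s that by simp
      have "cmod (U j k * W j l) \<le> 1" for j
        using norm_le_l2_norm[of ?I "(k, l)" "tensor (U j) (W j)"] kl U1 W1
        by (simp add: l2_norm_tensor)
      then show "\<forall>\<^sub>F j in sequentially. norm (X j $$ (k, l)) \<le> \<sigma> j"
        using pair(3) kl by (simp add: X_entry norm_mult mult_left_le)
    qed
    then show "(\<lambda>j. X j $$ (k, l)) \<longlonglongrightarrow> 0\<^sub>m M N $$ (k, l)" using kl by simp
  qed simp
  moreover have "\<exists>L. mat_LIMSEQ (\<lambda>j. outer_prod (u j) (conjugate (v j))) L \<and>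
             (\<exists>c. cmod c = 1 \<and>
                ((\<exists>z. L = c \<cdot>\<^sub>m outer_prod (z_vec M z) (z_vec N z)) \<or>
                 L = c \<cdot>\<^sub>m outer_prod (e_vec M) (e_vec N))) \<and>
             mat_LIMSEQ X (complex_of_real s \<cdot>\<^sub>m L) \<and>
             hankel_mat (complex_of_real s \<cdot>\<^sub>m L) \<and>
             vec_space.rank M (complex_of_real s \<cdot>\<^sub>m L) = 1" if "s > 0"
  proof -
    \<comment> \<open>A decreasing sequence stays above its limit, so every stage may be divided by
      its singular value.\<close>
    have pos: "0 < \<sigma> j" for j using s_le[of j] that by linarith
    have P: "is_hankel_proj M N (tensor (U j) (W j)) (\<lambda>p. complex_of_real (1 / \<sigma> j) * G j p)" for j
      using is_hankel_proj_scale[OF proj, of "1 / \<sigma> j" j] pos[of j] by simp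
    have L: "leading_pair M N (\<lambda>p. complex_of_real (1 / \<sigma> j) * G j p) (1 / \<sigma> j * \<sigma> (Suc j))
        (U (Suc j)) (W (Suc j))" for j
      using pos[of j] by (intro leading_pair_scale[OF leadG]) auto
    \<comment> \<open>Positivity of the limit is what turns convergence of the singular values into
      ratios tending to 1.\<close>
    have "(\<lambda>j. 1 / \<sigma> j * \<sigma> (Suc j)) \<longlonglongrightarrow> 1 / s * s"
      using that by (intro tendsto_intros s LIMSEQ_Suc[OF s]) auto
    then have ratio: "(\<lambda>j. 1 / \<sigma> j * \<sigma> (Suc j)) \<longlonglongrightarrow> 1" using that by simp
    obtain T c where lim: "\<forall>k<M. \<forall>l<N. (\<lambda>j. U j k * W j l) \<longlonglongrightarrow> T (k, l)"
      and T1: "l2_norm ?I T = 1"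
      and hankel: "\<forall>k<M. \<forall>k'<M. \<forall>l<N. \<forall>l'<N. k + l = k' + l' \<longrightarrow> T (k, l) = T (k', l')"
      and c: "cmod c = 1"
      and form: "rank1_hankel_form M N c T"
      using normalised_cadzow_convergence[OF MN(1,2) U1 W1 P L ratio]
      by (elim exE conjE) (rule that)
    have T: "(\<lambda>j. U j k * W j l) \<longlonglongrightarrow> T (k, l)" if "k < M" "l < N" for k l
      using lim that by blast
    define L where "L = mat M N T"
    have L: "L \<in> carrier_mat M N" by (simp add: L_def)
    have L_entry: "L $$ (k, l) = T (k, l)" if "k < M" "l < N" for k l
      using that by (simp add: L_def)
    have L_outer: "L = c \<cdot>\<^sub>m outer_prod a b"
      if "dim_vec a = M" "dim_vec b = N" "\<forall>k<M. \<forall>l<N. T (k, l) = c * (a $ k * b $ l)" for a b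
      by (rule eq_matI) (use that L in \<open>auto simp: L_entry outer_prod_def\<close>)
    have form': "(\<exists>z. L = c \<cdot>\<^sub>m outer_prod (z_vec M z) (z_vec N z)) \<or>
        L = c \<cdot>\<^sub>m outer_prod (e_vec M) (e_vec N)"
    proof -
      have "dim_vec (z_vec n z) = n" "dim_vec (e_vec n) = n" for n z
        by (simp_all add: z_vec_def e_vec_def)
      with form L_outer show ?thesis unfolding rank1_hankel_form_def by metis
    qed
    have "\<exists>p\<in>?I. T p \<noteq> 0"
    proof (rule ccontr)
      assume "\<not> ?thesis"
      then have "l2_norm ?I T = l2_norm ?I (\<lambda>_. 0)" by (intro l2_norm_cong) auto
      then show False using T1 by (simp add: l2_norm_def L2_set_def)
    qed
    then obtain p q where pq: "p < M" "q < N" "T (p, q) \<noteq> 0" by auto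
    obtain f g where fg: "\<And>k l. k < M \<Longrightarrow> l < N \<Longrightarrow> T (k, l) = f k * g l"
    proof -
      obtain a b where "\<forall>k<M. \<forall>l<N. T (k, l) = c * (a $ k * b $ l)"
        using form unfolding rank1_hankel_form_def by blast
      then show thesis
        by (intro that[of "\<lambda>k. c * a $ k" "\<lambda>l. b $ l"]) (simp add: mult.assoc)
    qed
    have "vec_space.rank M (complex_of_real s \<cdot>\<^sub>m L) = 1"
    proof (rule rank_one_rank)
      show "complex_of_real s \<cdot>\<^sub>m L \<in> carrier_mat M N" using L by simp
      show "(complex_of_real s \<cdot>\<^sub>m L) $$ (k, l) = (complex_of_real s * f k) * g l" if "k < M" "l < N" for k l
        using that L fg by (simp add: L_entry)
      show "p < M" "q < N" "(complex_of_real s \<cdot>\<^sub>m L) $$ (p, q) \<noteq> 0"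
        using pq L \<open>s > 0\<close> by (simp_all add: L_entry)
    qed
    moreover have "mat_LIMSEQ (\<lambda>j. outer_prod (u j) (conjugate (v j))) L"
      by (rule mat_LIMSEQ_entrywise[OF outer L]) (simp add: outer_entry L_entry T)
    moreover have "mat_LIMSEQ X (complex_of_real s \<cdot>\<^sub>m L)"
    proof (rule mat_LIMSEQ_entrywise[OF carrier_X])
      show "complex_of_real s \<cdot>\<^sub>m L \<in> carrier_mat M N" using L by simp
      fix k l assume kl: "k < M" "l < N"
      have "(\<lambda>j. complex_of_real (\<sigma> j) * (U j k * W j l)) \<longlonglongrightarrow> complex_of_real s * T (k, l)"
        by (intro tendsto_mult tendsto_of_real s T kl)
      then show "(\<lambda>j. X j $$ (k, l)) \<longlonglongrightarrow> (complex_of_real s \<cdot>\<^sub>m L) $$ (k, l)"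
        using kl L by (simp add: X_entry L_entry)
    qed
    moreover have "hankel_mat (complex_of_real s \<cdot>\<^sub>m L)"
      unfolding hankel_mat_def
    proof (intro allI impI)
      fix i j k l
      assume "i < dim_row (complex_of_real s \<cdot>\<^sub>m L)" "j < dim_col (complex_of_real s \<cdot>\<^sub>m L)"
        "k < dim_row (complex_of_real s \<cdot>\<^sub>m L)" "l < dim_col (complex_of_real s \<cdot>\<^sub>m L)" "i + j = k + l"
      then have b: "i < M" "j < N" "k < M" "l < N" and "i + j = k + l"
        using L by simp_all
      then have "T (i, j) = T (k, l)" using hankel by blast
      then show "(complex_of_real s \<cdot>\<^sub>m L) $$ (i, j) = (complex_of_real s \<cdot>\<^sub>m L) $$ (k, l)"
        using b L by (simp add: L_entry)
    qed
    ultimately show ?thesis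
      using form' c by (intro exI[of _ L] conjI exI[of _ c])
  qed
  ultimately show ?thesis
    using s unfolding X_def by (intro exI[of _ s] conjI impI)
qed

end
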